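(* Let $0<\delta<\tfrac12$. For $\alpha\in(0,1]$ put $\varphi_\alpha=\pi\frac{\sqrt{\alpha}}{1+\sqrt{\alpha}}$, and let $\alpha_\delta$ be the square of the root of the polynomial $(5-6\delta+\delta^2)X^3+(1-\delta^2)X^2-(2\delta+1)X-1$ that lies in $(0,1]$. Let $\mu$ be a probability measure on $\mathbb{S}^1$ with density $f:\mathbb{S}^1\to\mathbb{R}^+$, $f\in P(\alpha,\varphi)$, where $\alpha_\delta\leq\alpha\leq1$ and $\varphi\leq\delta\varphi_\alpha$. Let $p^*$ be the Fréchet mean of $\mu$ and, for $n\geq 1$, let $p_n^*$ be the empirical Fréchet mean of $n$ independent random variables $X_1,\dots,X_n$ with distribution $\mu$. Then for all $x>0$, $$\mathbb{P}\left(d_{\mathbb{S}^1}(p_n^*,p^* )\geq\sqrt{B(\alpha,\varphi)}\left(\frac{x}{n}\right)^{1/4}\right)\leq 2e^{-x},$$ where $$B(\alpha,\varphi)=C\max\left\{\frac{\pi^2}{\gamma(\alpha,\varphi)},\frac{2}{\alpha}\right\},\qquad \gamma(\alpha,\varphi)=\frac12\left(\alpha(\pi-\varphi)^2-\varphi^2\right),\qquad C=4\pi(2\pi^2+\pi+1).$$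
   Context: $\mathbb{S}^1=\{(x_1,x_2)\in\mathbb{R}^2 : x_1^2+x_2^2=1\}$ is endowed with the arclength distance $d_{\mathbb{S}^1}(x,p)=2\arcsin(\|x-p\|/2)$. For a Borel probability measure $\mu$ on $\mathbb{S}^1$, $F_\mu(p)=\frac12\int_{\mathbb{S}^1} d_{\mathbb{S}^1}^2(x,p)\,d\mu(x)$. The Fréchet mean of $\mu$ is the unique minimizer of $F_\mu$ on $\mathbb{S}^1$; under the stated hypotheses on $f$ the paper shows it exists. For $p\in\mathbb{S}^1$, $e_p:[-\pi,\pi)\to\mathbb{S}^1$ is the bijection $e_p(\theta)=R_\theta p$, with $R_\theta$ the rotation of angle $\theta$. Densities on $\mathbb{S}^1$ are with respect to arclength measure, and $f_p=f\circ e_p$. Property $P(p,\alpha,\varphi)$: for $p\in\mathbb{S}^1$, $\alpha\in(0,1]$, $\varphi\in(0,\pi)$, a probability density $f$ satisfies $P(p,\alpha,\varphi)$ if $f_p(\theta)\leq\frac{1-\alpha}{2\pi}$ for all $\theta\in[-\pi,\pi)$ with $|\theta|\geq\varphi$. One writes $f\in P(\alpha,\varphi)$ if there is a $p\in\mathbb{S}^1$ such that $f$ satisfies $P(p,\alpha,\varphi)$. The empirical measure is $\mu^n=\frac1n\sum_{i=1}^n\delta_{X_i}$, and the empirical Fréchet mean $p_n^*$ is the unique minimizer over $p\in\mathbb{S}^1$ of $F_{\mu^n}(p)=\frac1{2n}\sum_{i=1}^n d_{\mathbb{S}^1}^2(p,X_i)$; for a non-atomic $\mu$ it exists (is unique)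 almost surely. *)

theory Defs
  imports "HOL-Probability.Probability" "HOL-Computational_Algebra.Polynomial"
begin

definition S1 :: "(real \<times> real) set" where
  "S1 = {(x1, x2). x1\<^sup>2 + x2\<^sup>2 = 1}"

definition circle_dist :: "real \<times> real \<Rightarrow> real \<times> real \<Rightarrow> real" where
  "circle_dist x p = 2 * arcsin (norm (x - p) / 2)"

definition rotation :: "real \<Rightarrow> real \<times> real \<Rightarrow> real \<times> real" where
  "rotation \<theta> = (\<lambda>(x1, x2). (cos \<theta> * x1 - sin \<theta> * x2, sin \<theta> * x1 + cos \<theta> * x2))"

text \<open>Only the values on \<open>[-\<pi>, \<pi>)\<close> are used, where \<open>circle_exp p\<close> is a bijection onto the circle.\<close>

definition circle_exp :: "real \<times> real \<Rightarrow> real \<Rightarrow> real \<times> real" where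
  "circle_exp p \<theta> = rotation \<theta> p"

definition circle_borel :: "(real \<times> real) measure" where
  "circle_borel = restrict_space borel S1"

text \<open>Arclength is the image of Lebesgue measure under the unit-speed parametrisation of the circle
  that starts from \<open>(1, 0)\<close>; its total mass is \<open>2\<pi>\<close>.\<close>

definition arclength :: "(real \<times> real) measure" where
  "arclength = distr (restrict_space lborel {-pi..<pi}) circle_borel (circle_exp (1, 0))"

definition frechet_functional :: "(real \<times> real) measure \<Rightarrow> real \<times> real \<Rightarrow> real" where
  "frechet_functional \<mu> p = 1 / 2 * (\<integral>x. (circle_dist x p)\<^sup>2 \<partial>\<mu>)"

definition is_frechet_mean :: "(real \<times> real) measure \<Rightarrow> real \<times> real \<Rightarrow> bool" where
  "is_frechet_mean \<mu> p \<longleftrightarrow>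
     is_arg_min (frechet_functional \<mu>) (\<lambda>q. q \<in> S1) p \<and>
     (\<forall>q. is_arg_min (frechet_functional \<mu>) (\<lambda>q. q \<in> S1) q \<longrightarrow> q = p)"

text \<open>Uniqueness is part of \<^const>\<open>is_frechet_mean\<close>, so whenever the minimizer is not unique,
  \<open>frechet_mean \<mu>\<close> is the single unspecified point \<open>THE p. False\<close>, which does not depend on \<open>\<mu>\<close>.\<close>

definition frechet_mean :: "(real \<times> real) measure \<Rightarrow> real \<times> real" where
  "frechet_mean \<mu> = (THE p. is_frechet_mean \<mu> p)"

text \<open>The measure \<open>1/n (\<delta>\<^sub>x\<^sub>1 + \<dots> + \<delta>\<^sub>x\<^sub>n)\<close>, points counted with multiplicity, as the image of the
  uniform distribution on the indices.\<close>

definition empirical_measure :: "nat \<Rightarrow> (nat \<Rightarrow> real \<times> real) \<Rightarrow> (real \<times> real) measure" where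
  "empirical_measure n x = distr (uniform_count_measure {1..n}) circle_borel x"

lemma frechet_functional_empirical_measure:
  assumes "\<And>i. i \<in> {1..n} \<Longrightarrow> x i \<in> S1" and p: "p \<in> S1"
  shows "frechet_functional (empirical_measure n x) p
           = 1 / (2 * real n) * (\<Sum>i=1..n. (circle_dist p (x i))\<^sup>2)"
proof -
  have x: "x \<in> uniform_count_measure {1..n} \<rightarrow>\<^sub>M circle_borel"
    using assms by (auto simp: measurable_def circle_borel_def space_restrict_space
        space_uniform_count_measure sets_uniform_count_measure)
  have d: "(\<lambda>y. (circle_dist y p)\<^sup>2) \<in> borel_measurable circle_borel"
    unfolding circle_borel_def
  proof (rule borel_measurable_continuous_on_restrict)
    have "norm (y - p) \<le> 2" if "y \<in> S1" for y
    proof -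
      have "norm y = 1" "norm p = 1"
        using that p by (auto simp: S1_def norm_Pair)
      then show ?thesis using norm_triangle_ineq4[of y p] by simp
    qed
    moreover have "- 2 \<le> norm (y - p)" for y
      using norm_ge_zero[of "y - p"] by linarith
    ultimately show "continuous_on S1 (\<lambda>y. (circle_dist y p)\<^sup>2)"
      unfolding circle_dist_def by (intro continuous_intros) auto
  qed
  have "(\<integral>y. (circle_dist y p)\<^sup>2 \<partial>empirical_measure n x)
          = (\<integral>i. (circle_dist (x i) p)\<^sup>2 \<partial>uniform_count_measure {1..n})"
    unfolding empirical_measure_def by (rule integral_distr[OF x d])
  also have "\<dots> = (\<Sum>i=1..n. (circle_dist (x i) p)\<^sup>2) / real n"
    unfolding uniform_count_measure_def
    by (subst lebesgue_integral_point_measure_finite) (auto simp: sum_divide_distrib)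
  finally show ?thesis
    by (simp add: frechet_functional_def circle_dist_def norm_minus_commute)
qed

definition property_P :: "(real \<times> real \<Rightarrow> real) \<Rightarrow> real \<times> real \<Rightarrow> real \<Rightarrow> real \<Rightarrow> bool" where
  "property_P f p \<alpha> \<phi> \<longleftrightarrow>
     p \<in> S1 \<and> \<alpha> \<in> {0<..1} \<and> \<phi> \<in> {0<..<pi} \<and>
     (\<forall>\<theta>\<in>{-pi..<pi}. \<bar>\<theta>\<bar> \<ge> \<phi> \<longrightarrow> f (circle_exp p \<theta>) \<le> (1 - \<alpha>) / (2 * pi))"

definition in_class_P :: "(real \<times> real \<Rightarrow> real) \<Rightarrow> real \<Rightarrow> real \<Rightarrow> bool" where
  "in_class_P f \<alpha> \<phi> \<longleftrightarrow> (\<exists>p\<in>S1. property_P f p \<alpha> \<phi>)"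

definition phi_max :: "real \<Rightarrow> real" where
  "phi_max \<alpha> = pi * (sqrt \<alpha> / (1 + sqrt \<alpha>))"

text \<open>For \<open>0 < \<delta> < 1/2\<close> the coefficients change sign exactly once, and the polynomial takes the values
  \<open>-1\<close> at \<open>0\<close> and \<open>4 - 8\<delta> > 0\<close> at \<open>1\<close>, so the root in \<open>(0, 1]\<close> exists and is unique.\<close>

definition alpha_min :: "real \<Rightarrow> real" where
  "alpha_min \<delta> =
     (THE X. X \<in> {0<..1} \<and>
        poly [:-1, - (2 * \<delta> + 1), 1 - \<delta>\<^sup>2, 5 - 6 * \<delta> + \<delta>\<^sup>2:] X = 0)\<^sup>2"

definition gamma_const :: "real \<Rightarrow> real \<Rightarrow> real" where
  "gamma_const \<alpha> \<phi> = 1 / 2 * (\<alpha> * (pi - \<phi>)\<^sup>2 - \<phi>\<^sup>2)"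

definition C_const :: real where
  "C_const = 4 * pi * (2 * pi\<^sup>2 + pi + 1)"

definition B_const :: "real \<Rightarrow> real \<Rightarrow> real" where
  "B_const \<alpha> \<phi> = C_const * max (pi\<^sup>2 / gamma_const \<alpha> \<phi>) (2 / \<alpha>)"

end

theory Submission imports Defs "HOL-Probability.Hoeffding" begin

text \<open>
  Why the bound holds. Writing the points of the circle as \<open>circ t\<close>, the distance becomes
  \<open>angle_dist (a - b)\<close>, the least \<open>\<bar>a - b + 2\<pi>k\<bar>\<close>. Let \<open>F\<close> be the Frechet functional of \<open>\<mu>\<close>, \<open>F\<^sub>n\<close> that of
  the sample, \<open>q\<close> the Frechet mean and \<open>q\<^sub>n\<close> the empirical one.

  Growth (\<open>unique_min_growth\<close>). At every point \<open>F\<close> exceeds \<open>F q\<close> by at least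
  \<open>\<gamma> / (8 \<pi>\<^sup>2)\<close> times the squared distance to \<open>q\<close>. The second derivative of \<open>F\<close> at a point is \<open>1\<close> minus
  \<open>2\<pi>\<close> times the density at its antipode, so property \<open>P\<close> makes \<open>F\<close> strongly convex with modulus \<open>\<alpha>\<close>
  on the arc of radius \<open>\<pi> - \<phi>\<close> around \<open>p\<close> (\<open>cost_strongly_convex\<close>). On the opposite arc of radius \<open>\<phi>\<close>, \<open>F\<close> is
  compared with its value at the mean angle \<open>m\<close>, measured from \<open>p\<close>: the difference is at least
  \<open>\<gamma> - (\<pi> - \<phi>) \<bar>m\<bar>\<close> (\<open>far_growth\<close>), and the conditions on \<open>\<alpha>\<close>, \<open>\<phi>\<close> and \<open>\<delta>\<close> leave at least \<open>\<gamma> / 8\<close> of it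
  (\<open>far_gap_of_alpha_min\<close>).

  Deviation. For fixed \<open>\<theta>\<close> half the squared distance to \<open>circ \<theta>\<close> is a \<open>\<pi>\<close>-Lipschitz function of the angle,
  so \<open>\<bar>F\<^sub>n - F\<bar>\<close> is bounded, uniformly on the circle, by \<open>\<pi>\<close> times the \<open>L\<^sup>1\<close>-distance of the empirical
  and the true distribution function of the angles (\<open>Lipschitz_deviation_le\<close>). At each single
  threshold the exponential moment is controlled by Hoeffding's lemma, and convexity carries this over to the
  average over thresholds without any loss (\<open>averaged_deviation_tail\<close>). Hence the
  supremum of \<open>\<bar>F\<^sub>n - F\<bar>\<close> exceeds a fixed multiple of \<open>\<surd>(x / n)\<close> with probability at most \<open>2 exp (- x)\<close>.

  Conclusion. As \<open>F\<^sub>n q\<^sub>n \<le> F\<^sub>n q\<close>, the difference \<open>F q\<^sub>n - F q\<close> is at most twice that supremum, and \<open>C_const\<close> is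
  large enough to combine the two estimates.

  Existence and measurability of \<open>q\<^sub>n\<close>. A minimizer of \<open>F\<^sub>n\<close> is one of \<open>n\<close> explicit points, the mean angle
  shifted by multiples of \<open>2\<pi>/n\<close> (\<open>minimizer_is_critical\<close>); two of them can tie only if the sample
  satisfies a nontrivial affine relation, which has probability zero (\<open>AE_no_tie\<close>).
\<close>

section \<open>Angles and distances on the circle\<close>

definition circ :: "real \<Rightarrow> real \<times> real" where
  "circ t = (cos t, sin t)"

definition angle_dist :: "real \<Rightarrow> real" where
  "angle_dist u = 2 * arcsin \<bar>sin (u / 2)\<bar>"

lemma circ_in_S1 [simp]: "circ t \<in> S1"
  by (simp add: circ_def S1_def)

lemma circle_exp_circ: "circle_exp (circ s) t = circ (s + t)"
  by (simp add: circle_exp_def rotation_def circ_def cos_add sin_add algebra_simps)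

lemma S1_obtain_angle:
  assumes "q \<in> S1"
  obtains t where "-pi \<le> t" "t < pi" "q = circ t"
proof -
  have "(fst q)\<^sup>2 + (snd q)\<^sup>2 = 1"
    using assms by (auto simp: S1_def)
  then obtain t where t: "0 \<le> t" "t < 2 * pi" "fst q = cos t" "snd q = sin t"
    using sincos_total_2pi by metis
  show thesis
  proof (cases "t < pi")
    case True
    with t show ?thesis by (intro that[of t]) (auto simp: circ_def prod_eq_iff)
  next
    case False
    with t show ?thesis by (intro that[of "t - 2 * pi"]) (auto simp: circ_def prod_eq_iff cos_diff sin_diff)
  qed
qed

lemma circ_add_2pi_int: "circ (t + 2 * pi * real_of_int k) = circ t"
  by (simp add: circ_def sin_add cos_add sin_int_2pin cos_int_2pin)

lemma circle_dist_circ: "circle_dist (circ a) (circ b) = angle_dist (a - b)"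
proof -
  have "(norm (circ a - circ b))\<^sup>2 = (2 * sin ((a - b) / 2))\<^sup>2"
  proof -
    have "(norm (circ a - circ b))\<^sup>2 = (cos a - cos b)\<^sup>2 + (sin a - sin b)\<^sup>2"
      by (simp add: circ_def norm_Pair)
    also have "\<dots> = 2 - 2 * cos (a - b)"
      using sin_cos_squared_add[of a] sin_cos_squared_add[of b]
      by (simp add: cos_diff power2_eq_square algebra_simps)
    also have "cos (a - b) = 1 - 2 * (sin ((a - b) / 2))\<^sup>2"
      using cos_double_sin[of "(a - b) / 2"] by (metis nonzero_mult_div_cancel_left times_divide_eq_right zero_neq_numeral)
    finally show ?thesis by (simp add: power_mult_distrib)
  qed
  then have "norm (circ a - circ b) = \<bar>2 * sin ((a - b) / 2)\<bar>"
    by (metis real_sqrt_abs abs_norm_cancel)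
  then show ?thesis
    by (simp add: circle_dist_def angle_dist_def abs_mult)
qed

lemma angle_dist_eq_abs:
  assumes "\<bar>u\<bar> \<le> pi"
  shows "angle_dist u = \<bar>u\<bar>"
proof -
  have "\<bar>sin (u / 2)\<bar> = sin (\<bar>u\<bar> / 2)"
  proof (cases "u \<ge> 0")
    case True
    then show ?thesis using assms sin_ge_zero[of "u/2"] by simp
  next
    case False
    then show ?thesis using assms sin_ge_zero[of "-u/2"] by simp
  qed
  then show ?thesis
    using assms by (simp add: angle_dist_def arcsin_sin)
qed

lemma angle_dist_nonneg: "0 \<le> angle_dist u"
  unfolding angle_dist_def using arcsin_nonneg[of "\<bar>sin (u/2)\<bar>"] by simp

lemma angle_dist_le_pi: "angle_dist u \<le> pi"
  unfolding angle_dist_def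
  using arcsin_bounded[of "\<bar>sin (u/2)\<bar>"] order_trans[of "-1" 0 "\<bar>sin (u/2)\<bar>"] by simp

lemma angle_dist_uminus: "angle_dist (- u) = angle_dist u"
  by (simp add: angle_dist_def)

lemma angle_dist_add_2pi_int: "angle_dist (u + 2 * pi * real_of_int k) = angle_dist u"
proof -
  have "angle_dist (u + 2 * pi * real_of_int k) = circle_dist (circ (u + 2 * pi * real_of_int k)) (circ 0)"
    by (simp add: circle_dist_circ)
  also have "\<dots> = angle_dist u"
    by (simp add: circ_add_2pi_int circle_dist_circ)
  finally show ?thesis .
qed

lemma angle_dist_le_abs: "angle_dist u \<le> \<bar>u\<bar>"
  using angle_dist_eq_abs[of u] angle_dist_le_pi[of u] by (cases "\<bar>u\<bar> \<le> pi") auto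

text \<open>
  Together with \<open>angle_dist_le_abs\<close> and periodicity this says that \<open>angle_dist u\<close> is the least
  \<open>\<bar>u + 2\<pi>k\<bar>\<close> over the integers \<open>k\<close>. Most later estimates use only this description.
\<close>

lemma angle_dist_attained:
  obtains k :: int where "angle_dist u = \<bar>u + 2 * pi * real_of_int k\<bar>"
proof -
  obtain t where t: "-pi \<le> t" "t < pi" "circ u = circ t"
    using S1_obtain_angle[of "circ u"] by auto
  then have "cos u = cos t" "sin u = sin t" by (auto simp: circ_def)
  then obtain k where "u = t + 2 * pi * real_of_int k"
    using sin_cos_eq_iff[of u t] by (auto simp: algebra_simps)
  then have "u + 2 * pi * real_of_int (- k) = t" by simp
  moreover have "angle_dist u = \<bar>t\<bar>"
    using angle_dist_eq_abs[of t] t circle_dist_circ[of u 0] circle_dist_circ[of t 0] by simp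
  ultimately show thesis using that[of "-k"] by simp
qed

lemma angle_dist_Lipschitz: "\<bar>angle_dist u - angle_dist v\<bar> \<le> \<bar>u - v\<bar>"
proof -
  have *: "angle_dist u - angle_dist v \<le> \<bar>u - v\<bar>" for u v
  proof -
    obtain k where k: "angle_dist v = \<bar>v + 2 * pi * real_of_int k\<bar>"
      by (rule angle_dist_attained)
    have "angle_dist u = angle_dist (u + 2 * pi * real_of_int k)"
      by (simp add: angle_dist_add_2pi_int)
    also have "\<dots> \<le> \<bar>u + 2 * pi * real_of_int k\<bar>" by (rule angle_dist_le_abs)
    finally show ?thesis using k by linarith
  qed
  show ?thesis using *[of u v] *[of v u] by linarith
qed

lemma continuous_on_angle_dist [continuous_intros]:
  fixes h :: "real \<Rightarrow> real"
  assumes "continuous_on A h"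
  shows "continuous_on A (\<lambda>t. angle_dist (h t))"
proof -
  have "continuous_on A (\<lambda>t. \<bar>sin (h t / 2)\<bar>)"
    using assms by (intro continuous_intros) auto
  moreover have "-1 \<le> \<bar>y\<bar>" for y :: real by (rule order_trans[of _ 0]) auto
  ultimately have "continuous_on A (\<lambda>t. arcsin \<bar>sin (h t / 2)\<bar>)"
    by (intro continuous_on_arcsin) auto
  then show ?thesis
    unfolding angle_dist_def by (intro continuous_on_mult continuous_on_const)
qed

lemma angle_dist_measurable [measurable]: "angle_dist \<in> borel_measurable borel"
  by (intro borel_measurable_continuous_onI continuous_intros)

lemma half_sq_angle_dist_Lipschitz:
  "\<bar>1 / 2 * (angle_dist (s - \<theta>))\<^sup>2 - 1 / 2 * (angle_dist (t - \<theta>))\<^sup>2\<bar> \<le> pi * \<bar>s - t\<bar>"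
proof -
  let ?a = "angle_dist (s - \<theta>)" and ?b = "angle_dist (t - \<theta>)"
  have "1 / 2 * ?a\<^sup>2 - 1 / 2 * ?b\<^sup>2 = (?a + ?b) / 2 * (?a - ?b)"
    by (simp add: power2_eq_square field_simps)
  moreover have "0 \<le> (?a + ?b) / 2"
    using angle_dist_nonneg[of "s - \<theta>"] angle_dist_nonneg[of "t - \<theta>"] by simp
  ultimately have "\<bar>1 / 2 * ?a\<^sup>2 - 1 / 2 * ?b\<^sup>2\<bar> = (?a + ?b) / 2 * \<bar>?a - ?b\<bar>"
    by (simp only: abs_mult abs_of_nonneg)
  also have "\<dots> \<le> pi * \<bar>s - t\<bar>"
    using angle_dist_nonneg[of "s - \<theta>"] angle_dist_nonneg[of "t - \<theta>"]
      angle_dist_le_pi[of "s - \<theta>"] angle_dist_le_pi[of "t - \<theta>"]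
      angle_dist_Lipschitz[of "s - \<theta>" "t - \<theta>"]
    by (intro mult_mono) auto
  finally show ?thesis .
qed

lemma angle_dist_antipode:
  assumes "\<bar>u\<bar> \<le> 2 * pi"
  shows "angle_dist (u + pi) = \<bar>\<bar>u\<bar> - pi\<bar>" "angle_dist (u - pi) = \<bar>\<bar>u\<bar> - pi\<bar>"
proof -
  have 1: "angle_dist (u + pi) = angle_dist (u - pi)"
    using angle_dist_add_2pi_int[of "u - pi" 1] by (simp add: algebra_simps)
  show "angle_dist (u - pi) = \<bar>\<bar>u\<bar> - pi\<bar>"
  proof (cases "u \<ge> 0")
    case True
    then show ?thesis using angle_dist_eq_abs[of "u - pi"] assms by (auto simp: abs_le_iff)
  next
    case False
    then have "angle_dist (u + pi) = \<bar>u + pi\<bar>"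
      using assms by (intro angle_dist_eq_abs) (auto simp: abs_le_iff)
    then show ?thesis using False 1 by auto
  qed
  then show "angle_dist (u + pi) = \<bar>\<bar>u\<bar> - pi\<bar>" using 1 by simp
qed

text \<open>
  On the relevant range of angle differences the squared distance is a parabola, lowered by a
  convex term as soon as the difference exceeds \<open>\<pi>\<close> and the short way round is the other one.
\<close>

lemma angle_dist_sq_wrapped:
  assumes "\<bar>u\<bar> \<le> 2 * pi"
  shows "(angle_dist u)\<^sup>2 = u\<^sup>2 - 4 * pi * max 0 (\<bar>u\<bar> - pi)"
proof (cases "\<bar>u\<bar> \<le> pi")
  case True
  then show ?thesis by (simp add: angle_dist_eq_abs)
next
  case False
  have "angle_dist u = \<bar>2 * pi - \<bar>u\<bar>\<bar>"
  proof (cases "u \<ge> 0")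
    case True
    have "angle_dist u = angle_dist (u - pi - pi)"
      using angle_dist_add_2pi_int[of u "-1"] by (simp add: algebra_simps)
    then show ?thesis using angle_dist_antipode(2)[of "u - pi"] assms False True by auto
  next
    case f: False
    have "angle_dist u = angle_dist (u + pi + pi)"
      using angle_dist_add_2pi_int[of u 1] by (simp add: algebra_simps)
    then show ?thesis using angle_dist_antipode(1)[of "u + pi"] assms False f by auto
  qed
  then have "(angle_dist u)\<^sup>2 = (2 * pi - \<bar>u\<bar>)\<^sup>2" by simp
  also have "\<dots> = u\<^sup>2 - 4 * pi * max 0 (\<bar>u\<bar> - pi)"
    using False by (simp add: power2_diff algebra_simps power2_eq_square)
  finally show ?thesis .
qed

section \<open>The condition on the concentration parameters\<close>

text \<open>
  In the units \<open>s = \<surd>\<alpha>\<close> and \<open>u = \<phi>/\<pi>\<close>, the polynomial condition on \<open>\<alpha>\<close> together with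
  \<open>\<phi> \<le> \<delta> phi_max \<alpha>\<close> confines \<open>(s, u)\<close> to the region \<open>bound\<close>, in which \<open>\<delta>\<close> no longer occurs;
  \<open>v\<close> stands for the absolute mean angle divided by \<open>\<pi>\<close>. The inequality holds because the
  straight line \<open>l\<close> separates \<open>bound\<close> from the region where it fails, which leaves two polynomial
  inequalities in \<open>s\<close> alone on \<open>[0.62, 1]\<close>. The factor \<open>7/8\<close> is not optimal; it is small enough for
  the constant \<open>C_const\<close> to absorb the remaining \<open>1/8\<close>.
\<close>

lemma far_gap_inequality:
  fixes s u v :: real
  assumes s: "0 < s" "s \<le> 1" and u: "0 \<le> u" "u < 1"
    and bound: "u * ((6 * s\<^sup>2 + 2) * (1 + s)) \<le> 5 * s ^ 3 + s\<^sup>2 - s - 1"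
    and v: "v \<le> u + (1 - s\<^sup>2) * (1 - u)\<^sup>2 / 4"
  shows "2 * (1 - u) * v \<le> 7 / 8 * (s\<^sup>2 * (1 - u)\<^sup>2 - u\<^sup>2)"
proof -
  have s62: "s \<ge> 62 / 100"
  proof (rule ccontr)
    assume "\<not> s \<ge> 62 / 100"
    then have s': "s \<le> 62 / 100" by simp
    have "s\<^sup>2 \<le> (62 / 100)\<^sup>2" using s s' by (intro power_mono) auto
    then have "5 * s\<^sup>2 + s - 1 \<le> 5 * (62 / 100)\<^sup>2 + 62 / 100 - 1"
      using s' by simp
    then have "s * (5 * s\<^sup>2 + s - 1) \<le> s * (5 * (62 / 100)\<^sup>2 + 62 / 100 - 1)"
      using s by (intro mult_left_mono) auto
    also have "\<dots> \<le> 62 / 100 * (5 * (62 / 100)\<^sup>2 + 62 / 100 - 1)"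
      using s' by (intro mult_right_mono) (auto simp: power2_eq_square)
    also have "\<dots> < 1" by (simp add: power2_eq_square)
    finally have "5 * s ^ 3 + s\<^sup>2 - s - 1 < 0"
      by (simp add: power2_eq_square power3_eq_cube algebra_simps)
    moreover have "0 \<le> u * ((6 * s\<^sup>2 + 2) * (1 + s))"
      using u s by simp
    ultimately show False using bound by linarith
  qed
  \<comment> \<open>Between \<open>s = 0.62\<close> and \<open>s = 1\<close> the largest \<open>u\<close> allowed by \<open>bound\<close> and the largest \<open>u\<close> for which
    \<open>Q u \<ge> 0\<close> differ by about \<open>0.02\<close>; this line runs between the two curves.\<close>
  define l where "l = 68 / 100 * s - 41 / 100"
  have ul: "u \<le> l"
  proof -
    \<comment> \<open>The polynomial is close to having a double root near \<open>4/5\<close>, hence this form.\<close>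
    have eq: "50 * (l * ((6 * s\<^sup>2 + 2) * (1 + s)) - (5 * s ^ 3 + s\<^sup>2 - s - 1))
        = (s - 4 / 5)\<^sup>2 * (204 * s\<^sup>2 + 1574 / 10 * s + 1628 / 100)
          + (2312 / 1000 * s - 14192 / 10000)"
      unfolding l_def by algebra
    have "0 \<le> (s - 4 / 5)\<^sup>2 * (204 * s\<^sup>2 + 1574 / 10 * s + 1628 / 100)
          + (2312 / 1000 * s - 14192 / 10000)"
      using s s62 by (intro add_nonneg_nonneg mult_nonneg_nonneg) auto
    then have "5 * s ^ 3 + s\<^sup>2 - s - 1 \<le> l * ((6 * s\<^sup>2 + 2) * (1 + s))"
      unfolding eq[symmetric] by simp
    with bound have "u * ((6 * s\<^sup>2 + 2) * (1 + s)) \<le> l * ((6 * s\<^sup>2 + 2) * (1 + s))" by linarith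
    moreover have "0 < (6 * s\<^sup>2 + 2) * (1 + s)" using s by (intro mult_pos_pos add_nonneg_pos) auto
    ultimately show ?thesis by (rule mult_right_le_imp_le)
  qed
  have l1: "l \<le> 27 / 100" using s by (simp add: l_def)
  \<comment> \<open>Up to the factor \<open>8\<close>, the difference of both sides once \<open>(1 - u)\<^sup>3\<close> is replaced by \<open>(1 - u)\<^sup>2\<close>.\<close>
  define Q where "Q = (\<lambda>t. (11 * s\<^sup>2 - 4) * (1 - t)\<^sup>2 + 9 * t\<^sup>2 - 16 * t)"
  have "62 / 100 * (62 / 100) \<le> s * s" using s62 s by (intro mult_mono) auto
  then have S: "11 * s\<^sup>2 - 4 \<ge> 0" by (simp add: power2_eq_square)
  \<comment> \<open>Polynomial division of the left-hand side by \<open>(s - 0.62) (1 - s)\<close>, which is nonnegative on the interval.\<close>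
  have "Q l = (s - 62 / 100) * (1 - s) * (200838 / 15625 * s - 3179 / 625 * s\<^sup>2 - 1279051 / 6250000)
       + (22744331 / 312500000 * s - 1994331 / 312500000)"
    unfolding Q_def l_def by algebra
  moreover have "0 \<le> (s - 62 / 100) * (1 - s) * (200838 / 15625 * s - 3179 / 625 * s\<^sup>2 - 1279051 / 6250000)"
  proof -
    have "s\<^sup>2 \<le> s" using s by (simp add: power2_eq_square mult_left_le)
    then have "0 \<le> 200838 / 15625 * s - 3179 / 625 * s\<^sup>2 - 1279051 / 6250000"
      using s62 by linarith
    then show ?thesis using s s62 by (intro mult_nonneg_nonneg) auto
  qed
  ultimately have "0 \<le> Q l" using s62 by linarith
  also have "Q l \<le> Q u"
  proof -
    have "(11 * s\<^sup>2 - 4) * (1 - l)\<^sup>2 \<le> (11 * s\<^sup>2 - 4) * (1 - u)\<^sup>2"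
      using S ul l1 by (intro mult_left_mono power_mono) auto
    moreover have "9 * l\<^sup>2 - 16 * l \<le> 9 * u\<^sup>2 - 16 * u"
    proof -
      have "0 \<le> (l - u) * (16 - 9 * (l + u))" using ul l1 by (intro mult_nonneg_nonneg) auto
      then show ?thesis by (simp add: power2_eq_square algebra_simps)
    qed
    ultimately show ?thesis unfolding Q_def by linarith
  qed
  finally have Q: "0 \<le> Q u" .
  have "2 * (1 - u) * v \<le> 2 * (1 - u) * (u + (1 - s\<^sup>2) * (1 - u)\<^sup>2 / 4)"
    using u v by (intro mult_left_mono) auto
  also have "\<dots> = 2 * (1 - u) * u + (1 - s\<^sup>2) * (1 - u) ^ 3 / 2"
    by (simp add: power2_eq_square power3_eq_cube field_simps)
  also have "\<dots> \<le> 2 * (1 - u) * u + (1 - s\<^sup>2) * (1 - u)\<^sup>2 / 2"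
  proof (intro add_left_mono divide_right_mono mult_left_mono)
    show "(1 - u) ^ 3 \<le> (1 - u)\<^sup>2" using u by (intro power_decreasing) auto
    show "0 \<le> 1 - s\<^sup>2" using s by (simp add: power_le_one)
  qed simp
  also have "\<dots> = 7 / 8 * (s\<^sup>2 * (1 - u)\<^sup>2 - u\<^sup>2) - Q u / 8"
    by (simp add: Q_def power2_eq_square field_simps)
  also have "\<dots> \<le> 7 / 8 * (s\<^sup>2 * (1 - u)\<^sup>2 - u\<^sup>2)" using Q by linarith
  finally show ?thesis .
qed

lemma alpha_min_le_imp_poly_nonneg:
  fixes \<delta> s :: real
  assumes delta: "0 < \<delta>" "\<delta> < 1 / 2" and s: "0 < s" "alpha_min \<delta> \<le> s\<^sup>2"
  shows "(1 + 2 * \<delta>) * s + 1 \<le> (5 - 6 * \<delta> + \<delta>\<^sup>2) * s ^ 3 + (1 - \<delta>\<^sup>2) * s\<^sup>2"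
proof -
  define P where "P = [:-1, - (2 * \<delta> + 1), 1 - \<delta>\<^sup>2, 5 - 6 * \<delta> + \<delta>\<^sup>2:]"
  define a where "a = 5 - 6 * \<delta> + \<delta>\<^sup>2"
  define b where "b = 1 - \<delta>\<^sup>2"
  have a: "a > 0"
  proof -
    have "a = (5 - \<delta>) * (1 - \<delta>)" by (simp add: a_def power2_eq_square algebra_simps)
    then show ?thesis using delta by simp
  qed
  have b: "b > 0"
  proof -
    have "b = (1 + \<delta>) * (1 - \<delta>)" by (simp add: b_def power2_eq_square algebra_simps)
    then show ?thesis using delta by simp
  qed
  have polyP: "poly P t = a * t ^ 3 + b * t\<^sup>2 - (2 * \<delta> + 1) * t - 1" for t
    by (simp add: P_def a_def b_def power2_eq_square power3_eq_cube algebra_simps)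
  \<comment> \<open>Divided by \<open>t\<close>, the polynomial is strictly increasing on the positive half-line.\<close>
  have mono: "poly P t / t < poly P t' / t'" if "0 < t" "t < t'" for t t'
  proof -
    have eq: "poly P t / t = a * t\<^sup>2 + b * t - (2 * \<delta> + 1) - 1 / t" if "t > 0" for t
      using that by (simp add: polyP field_simps power2_eq_square power3_eq_cube)
    have "a * t\<^sup>2 < a * t'\<^sup>2" "b * t < b * t'" "1 / t' < 1 / t"
      using that a b by (auto intro!: power_strict_mono divide_strict_left_mono)
    then show ?thesis using eq[of t] eq[of t'] that by linarith
  qed
  have "\<exists>X. 0 < X \<and> X \<le> 1 \<and> poly P X = 0"
  proof -
    have "poly P 0 < 0" "0 < poly P 1" using delta by (simp_all add: P_def)
    then obtain X where "0 < X" "X < 1" "poly P X = 0"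
      using poly_IVT_pos[of 0 1 P] by auto
    then show ?thesis by (intro exI[of _ X]) auto
  qed
  then obtain X where X: "0 < X" "X \<le> 1" "poly P X = 0" by auto
  have "(THE X. X \<in> {0<..1} \<and> poly P X = 0) = X"
  proof (rule the_equality)
    show "X \<in> {0<..1} \<and> poly P X = 0" using X by simp
    fix Y assume Y: "Y \<in> {0<..1} \<and> poly P Y = 0"
    then show "Y = X" using mono[of X Y] mono[of Y X] X by (cases X Y rule: linorder_cases) auto
  qed
  then have "X\<^sup>2 \<le> s\<^sup>2" using s by (simp add: alpha_min_def P_def)
  then have "X \<le> s" using s X by (simp add: power2_le_iff_abs_le)
  then have "0 \<le> poly P s / s" using mono[of X s] X by (cases "X = s") auto
  then have "0 \<le> poly P s" using s by (simp add: zero_le_divide_iff)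
  then show ?thesis by (simp add: polyP a_def b_def algebra_simps)
qed

text \<open>
  The conditions involving \<open>\<delta>\<close> enter the theorem only through this lemma. The left-hand side is \<open>\<pi> - \<phi>\<close> times
  the bound on the mean angle in \<open>abs_mean_le\<close>, which is what the far part of the circle can
  lose against \<open>gamma_const\<close> in \<open>far_growth\<close>.
\<close>

lemma far_gap_of_alpha_min:
  fixes \<alpha> \<phi> \<delta> :: real
  assumes delta: "0 < \<delta>" "\<delta> < 1 / 2"
    and alpha: "0 < \<alpha>" "alpha_min \<delta> \<le> \<alpha>" "\<alpha> \<le> 1"
    and phi: "0 < \<phi>" "\<phi> \<le> \<delta> * phi_max \<alpha>"
  shows "(pi - \<phi>) * (\<phi> + (1 - \<alpha>) * (pi - \<phi>)\<^sup>2 / (4 * pi)) \<le> 7 / 8 * gamma_const \<alpha> \<phi>"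
    and "0 < gamma_const \<alpha> \<phi>"
proof -
  define s where "s = sqrt \<alpha>"
  have s: "0 < s" "s \<le> 1" and s2: "s\<^sup>2 = \<alpha>" using alpha by (auto simp: s_def)
  define u where "u = \<phi> / pi"
  have phi_u: "\<phi> = pi * u" by (simp add: u_def)
  have u0: "0 < u" using phi by (simp add: u_def)
  have "pi * u \<le> pi * (\<delta> * (s / (1 + s)))"
    using phi by (simp add: phi_u phi_max_def s_def mult_ac)
  then have "u \<le> \<delta> * (s / (1 + s))" by (simp only: mult_le_cancel_left_pos[OF pi_gt_zero])
  then have us: "u * (1 + s) \<le> \<delta> * s" using s by (simp add: field_simps)
  have "\<delta> * s < 1 * s" using delta s by (intro mult_strict_right_mono) auto
  with us have "u * (1 + s) < s" by simp
  then have us': "u < s * (1 - u)" by (simp add: algebra_simps)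
  then have "0 < s * (1 - u)" using u0 by simp
  then have u1: "u < 1" using s by (simp add: zero_less_mult_iff)
  have "u\<^sup>2 < (s * (1 - u))\<^sup>2" using us' u0 by (intro power_strict_mono) auto
  then have "0 < pi\<^sup>2 * (s\<^sup>2 * (1 - u)\<^sup>2 - u\<^sup>2)" by (simp add: power_mult_distrib)
  also have g: "pi\<^sup>2 * (s\<^sup>2 * (1 - u)\<^sup>2 - u\<^sup>2) = 2 * gamma_const \<alpha> \<phi>"
    by (simp add: gamma_const_def s2[symmetric] phi_u power2_eq_square algebra_simps)
  finally show "0 < gamma_const \<alpha> \<phi>" by simp
  have "u * ((6 * s\<^sup>2 + 2) * (1 + s)) = (6 * s\<^sup>2 + 2) * (u * (1 + s))" by simp
  also have "\<dots> \<le> (6 * s\<^sup>2 + 2) * (\<delta> * s)" using us by (intro mult_left_mono) auto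
  also have "\<dots> \<le> 5 * s ^ 3 + s\<^sup>2 - s - 1"
  proof -
    have "s ^ 3 \<le> s\<^sup>2" using s by (intro power_decreasing) auto
    then have "\<delta>\<^sup>2 * s ^ 3 \<le> \<delta>\<^sup>2 * s\<^sup>2" by (intro mult_left_mono) auto
    moreover have "(1 + 2 * \<delta>) * s + 1 \<le> (5 - 6 * \<delta> + \<delta>\<^sup>2) * s ^ 3 + (1 - \<delta>\<^sup>2) * s\<^sup>2"
      using alpha s2 by (intro alpha_min_le_imp_poly_nonneg[OF delta s(1)]) simp
    ultimately show ?thesis
      by (simp add: algebra_simps power2_eq_square power3_eq_cube)
  qed
  finally have "2 * (1 - u) * (u + (1 - s\<^sup>2) * (1 - u)\<^sup>2 / 4) \<le> 7 / 8 * (s\<^sup>2 * (1 - u)\<^sup>2 - u\<^sup>2)"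
    using far_gap_inequality[OF s _ u1] u0 by simp
  then have "pi\<^sup>2 / 2 * (2 * (1 - u) * (u + (1 - s\<^sup>2) * (1 - u)\<^sup>2 / 4))
       \<le> pi\<^sup>2 / 2 * (7 / 8 * (s\<^sup>2 * (1 - u)\<^sup>2 - u\<^sup>2))"
    by (intro mult_left_mono) auto
  also have "pi\<^sup>2 / 2 * (2 * (1 - u) * (u + (1 - s\<^sup>2) * (1 - u)\<^sup>2 / 4))
      = (pi - \<phi>) * (\<phi> + (1 - \<alpha>) * (pi - \<phi>)\<^sup>2 / (4 * pi))"
    by (simp add: s2[symmetric] phi_u power2_eq_square field_simps)
  also have "pi\<^sup>2 / 2 * (7 / 8 * (s\<^sup>2 * (1 - u)\<^sup>2 - u\<^sup>2)) = 7 / 8 * gamma_const \<alpha> \<phi>"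
  proof -
    have "pi\<^sup>2 / 2 * (7 / 8 * y) = 7 / 16 * (pi\<^sup>2 * y)" for y :: real by simp
    then show ?thesis by (simp only: g)
  qed
  finally show "(pi - \<phi>) * (\<phi> + (1 - \<alpha>) * (pi - \<phi>)\<^sup>2 / (4 * pi)) \<le> 7 / 8 * gamma_const \<alpha> \<phi>" .
qed

section \<open>Growth of the Frechet functional of an angle law\<close>

lemma integral_positive_part:
  assumes "- pi \<le> c"
  shows "((\<lambda>t. max 0 (t - c)) has_integral (max 0 (pi - c))\<^sup>2 / 2) {-pi..pi}"
proof (cases "c \<le> pi")
  case True
  have "((\<lambda>t. t - c) has_integral (pi - c)\<^sup>2 / 2 - (c - c)\<^sup>2 / 2) {c..pi}"
    using True by (intro fundamental_theorem_of_calculus)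
      (auto intro!: derivative_eq_intros simp flip: has_real_derivative_iff_has_vector_derivative)
  then have "((\<lambda>t. t - c) has_integral (max 0 (pi - c))\<^sup>2 / 2) {c..pi}"
    using True by simp
  moreover have "{c..pi} \<subseteq> {-pi..pi}" using assms by auto
  ultimately have "((\<lambda>t. if t \<in> {c..pi} then t - c else 0) has_integral (max 0 (pi - c))\<^sup>2 / 2) {-pi..pi}"
    by (simp only: has_integral_restrict)
  then show ?thesis by (rule has_integral_eq[rotated]) auto
next
  case False
  then have "((\<lambda>t. max 0 (t - c)) has_integral 0) {-pi..pi}"
    by (intro has_integral_is_0) auto
  with False show ?thesis by simp
qed

lemma integral_negative_part:
  assumes "- pi \<le> c"
  shows "((\<lambda>t. max 0 (- t - c)) has_integral (max 0 (pi - c))\<^sup>2 / 2) {-pi..pi}"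
proof -
  have "((\<lambda>t. (\<lambda>t. max 0 (t - c)) (- t)) has_integral (max 0 (pi - c))\<^sup>2 / 2) {-pi..- (-pi)}"
    using integral_positive_part[OF assms] by (subst has_integral_reflect_real) simp
  then show ?thesis by simp
qed

text \<open>How far \<open>t\<close> lies beyond the antipode of \<open>\<theta>\<close>.\<close>

definition overshoot :: "real \<Rightarrow> real \<Rightarrow> real" where
  "overshoot \<theta> t = max 0 (\<bar>t - \<theta>\<bar> - pi)"

lemma continuous_on_overshoot [continuous_intros]: "continuous_on A (overshoot \<theta>)"
  unfolding overshoot_def by (intro continuous_intros)

lemma overshoot_nonneg [simp]: "0 \<le> overshoot \<theta> t"
  by (simp add: overshoot_def)

lemma integral_overshoot:
  assumes "\<bar>\<theta>\<bar> \<le> pi"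
  shows "(overshoot \<theta> has_integral \<theta>\<^sup>2 / 2) {-pi..pi}"
proof -
  have "((\<lambda>t. max 0 (t - (\<theta> + pi)) + max 0 (- t - (pi - \<theta>))) has_integral
      ((max 0 (pi - (\<theta> + pi)))\<^sup>2 / 2 + (max 0 (pi - (pi - \<theta>)))\<^sup>2 / 2)) {-pi..pi}"
    using assms by (intro has_integral_add integral_positive_part integral_negative_part) auto
  moreover have "(max 0 (pi - (\<theta> + pi)))\<^sup>2 / 2 + (max 0 (pi - (pi - \<theta>)))\<^sup>2 / 2 = \<theta>\<^sup>2 / 2"
    by (auto simp: max_def)
  moreover have "(\<lambda>t. max 0 (t - (\<theta> + pi)) + max 0 (- t - (pi - \<theta>))) = overshoot \<theta>"
    unfolding overshoot_def using pi_gt_zero by (intro ext) linarith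
  ultimately show ?thesis by (simp only:)
qed

lemma overshoot_convex:
  assumes "0 \<le> \<epsilon>" "\<epsilon> \<le> 1"
  shows "overshoot ((1 - \<epsilon>) * a + \<epsilon> * b) t \<le> (1 - \<epsilon>) * overshoot a t + \<epsilon> * overshoot b t"
proof -
  have "\<bar>t - ((1 - \<epsilon>) * a + \<epsilon> * b)\<bar> = \<bar>(1 - \<epsilon>) * (t - a) + \<epsilon> * (t - b)\<bar>"
    by (simp add: algebra_simps)
  also have "\<dots> \<le> (1 - \<epsilon>) * \<bar>t - a\<bar> + \<epsilon> * \<bar>t - b\<bar>"
    using assms by (intro order_trans[OF abs_triangle_ineq]) (simp add: abs_mult)
  finally have "\<bar>t - ((1 - \<epsilon>) * a + \<epsilon> * b)\<bar> - pi \<le> (1 - \<epsilon>) * (\<bar>t - a\<bar> - pi) + \<epsilon> * (\<bar>t - b\<bar> - pi)"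
    by (simp add: algebra_simps)
  also have "\<dots> \<le> (1 - \<epsilon>) * overshoot a t + \<epsilon> * overshoot b t"
    using assms by (intro add_mono mult_left_mono) (auto simp: overshoot_def)
  finally show ?thesis
    using assms by (auto simp: overshoot_def[of "(1 - \<epsilon>) * a + \<epsilon> * b"])
qed

text \<open>
  On \<open>[-\<phi>, \<phi>]\<close> the convex function \<open>\<bar>t - a\<bar>\<close> lies below the chord through its end points; beyond the
  interval the right-hand side continues it with its own slopes. Taking expectations,
  only the mean and the two tails remain.
\<close>

lemma chord_bound:
  fixes a \<phi> t :: real
  assumes "0 < \<phi>" "\<bar>a\<bar> \<le> \<phi>"
  shows "\<bar>t - a\<bar> \<le> \<phi> - a / \<phi> * t + (1 + a / \<phi>) * max 0 (t - \<phi>) + (1 - a / \<phi>) * max 0 (- t - \<phi>)"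
proof -
  define r where "r = a / \<phi>"
  have a: "a = r * \<phi>" using assms by (simp add: r_def field_simps)
  have r: "\<bar>r\<bar> \<le> 1" using assms by (simp add: r_def)
  consider "t \<ge> \<phi>" | "t \<le> - \<phi>" | "\<bar>t\<bar> \<le> \<phi>" by linarith
  then show ?thesis
  proof cases
    case 1
    then have "\<bar>t - a\<bar> = t - a" using assms by auto
    then show ?thesis using 1 assms unfolding r_def[symmetric] by (simp add: a algebra_simps)
  next
    case 2
    then have "\<bar>t - a\<bar> = a - t" using assms by auto
    then show ?thesis using 2 assms unfolding r_def[symmetric] by (simp add: a algebra_simps)
  next
    case 3
    have "0 \<le> (1 + r) * (\<phi> - t)" "0 \<le> (1 - r) * (\<phi> + t)"
      using r 3 by (auto intro!: mult_nonneg_nonneg)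
    then have "t - a \<le> \<phi> - r * t" "a - t \<le> \<phi> - r * t"
      by (simp_all add: a algebra_simps)
    moreover have "max 0 (t - \<phi>) = 0" "max 0 (- t - \<phi>) = 0" using 3 by auto
    ultimately show ?thesis unfolding r_def[symmetric] by simp
  qed
qed

text \<open>
  The law of the angle between a random point and the centre \<open>p\<close> of property \<open>P\<close>. The density bound
  is recorded in integrated form, tested against functions that vanish near \<open>p\<close>: the overshoots of
  angles near \<open>0\<close> are of this kind.
\<close>

locale light_tail_angle_law = prob_space \<nu> for \<nu> :: "real measure" +
  fixes \<alpha> \<phi> :: real
  assumes sets_law [measurable_cong]: "sets \<nu> = sets borel"
    and support: "AE t in \<nu>. \<bar>t\<bar> \<le> pi"
    and alpha: "0 < \<alpha>" "\<alpha> \<le> 1"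
    and phi: "0 < \<phi>" "\<phi> < pi"
    and tail_dominated: "\<And>h. continuous_on UNIV h \<Longrightarrow> (\<And>t. 0 \<le> h t) \<Longrightarrow> (\<And>t. \<bar>t\<bar> < \<phi> \<Longrightarrow> h t = 0) \<Longrightarrow>
        expectation h \<le> (1 - \<alpha>) / (2 * pi) * integral {-pi..pi} h"
begin

lemma integrable_continuous:
  fixes h :: "real \<Rightarrow> real"
  assumes "continuous_on UNIV h"
  shows "integrable \<nu> h"
proof -
  have [measurable]: "h \<in> borel_measurable borel"
    using assms by (rule borel_measurable_continuous_onI)
  have "compact (h ` {-pi..pi})"
    using assms by (intro compact_continuous_image) (auto intro: continuous_on_subset)
  then obtain B where B: "\<And>t. t \<in> {-pi..pi} \<Longrightarrow> norm (h t) \<le> B"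
    using compact_imp_bounded bounded_iff by (metis imageI)
  have "AE t in \<nu>. norm (h t) \<le> B"
    using support by eventually_elim (rule B, auto simp: abs_le_iff)
  then show ?thesis by (intro integrable_const_bound) auto
qed

abbreviation mean :: real where
  "mean \<equiv> expectation (\<lambda>t. t)"

definition tail_bound :: real where
  "tail_bound = (1 - \<alpha>) * (pi - \<phi>)\<^sup>2 / (4 * pi)"

lemma positive_tail: "expectation (\<lambda>t. max 0 (t - \<phi>)) \<le> tail_bound"
proof -
  have "expectation (\<lambda>t. max 0 (t - \<phi>)) \<le> (1 - \<alpha>) / (2 * pi) * integral {-pi..pi} (\<lambda>t. max 0 (t - \<phi>))"
    by (intro tail_dominated continuous_intros) auto
  also have "integral {-pi..pi} (\<lambda>t. max 0 (t - \<phi>)) = (pi - \<phi>)\<^sup>2 / 2"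
    using integral_positive_part[of \<phi>] phi by (simp add: integral_unique)
  finally show ?thesis by (simp add: tail_bound_def)
qed

lemma negative_tail: "expectation (\<lambda>t. max 0 (- t - \<phi>)) \<le> tail_bound"
proof -
  have "expectation (\<lambda>t. max 0 (- t - \<phi>)) \<le> (1 - \<alpha>) / (2 * pi) * integral {-pi..pi} (\<lambda>t. max 0 (- t - \<phi>))"
    by (intro tail_dominated continuous_intros) auto
  also have "integral {-pi..pi} (\<lambda>t. max 0 (- t - \<phi>)) = (pi - \<phi>)\<^sup>2 / 2"
    using integral_negative_part[of \<phi>] phi by (simp add: integral_unique)
  finally show ?thesis by (simp add: tail_bound_def)
qed

lemma abs_mean_le: "\<bar>mean\<bar> \<le> \<phi> + tail_bound"
proof -
  have int: "integrable \<nu> (\<lambda>t. max 0 (t - \<phi>))" "integrable \<nu> (\<lambda>t. max 0 (- t - \<phi>))" "integrable \<nu> (\<lambda>t. t)"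
    by (intro integrable_continuous continuous_intros)+
  have "mean \<le> expectation (\<lambda>t. \<phi> + max 0 (t - \<phi>))"
    using int by (intro integral_mono) auto
  also have "\<dots> \<le> \<phi> + tail_bound"
    using int positive_tail by (simp add: prob_space)
  finally have 1: "mean \<le> \<phi> + tail_bound" .
  have "- mean = expectation (\<lambda>t. - t)" by simp
  also have "\<dots> \<le> expectation (\<lambda>t. \<phi> + max 0 (- t - \<phi>))"
    using int by (intro integral_mono) auto
  also have "\<dots> \<le> \<phi> + tail_bound"
    using int negative_tail by (simp add: prob_space)
  finally show ?thesis using 1 by simp
qed

definition cost :: "real \<Rightarrow> real" where
  "cost \<theta> = 1 / 2 * expectation (\<lambda>t. (angle_dist (t - \<theta>))\<^sup>2)"

lemma cost_Lipschitz: "\<bar>cost \<theta> - cost \<theta>'\<bar> \<le> pi * \<bar>\<theta> - \<theta>'\<bar>"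
proof -
  let ?h = "\<lambda>\<theta> t. 1 / 2 * (angle_dist (t - \<theta>))\<^sup>2"
  have int: "integrable \<nu> (?h \<theta>)" for \<theta>
    by (intro integrable_continuous continuous_intros)
  have "cost \<theta> - cost \<theta>' = expectation (\<lambda>t. ?h \<theta> t - ?h \<theta>' t)"
    using int[of \<theta>] int[of \<theta>'] by (simp add: cost_def)
  moreover have "\<bar>expectation (\<lambda>t. ?h \<theta> t - ?h \<theta>' t)\<bar> \<le> expectation (\<lambda>t. \<bar>?h \<theta> t - ?h \<theta>' t\<bar>)"
    by (rule integral_abs_bound)
  moreover have "expectation (\<lambda>t. \<bar>?h \<theta> t - ?h \<theta>' t\<bar>) \<le> pi * \<bar>\<theta> - \<theta>'\<bar>"
  proof -
    have "expectation (\<lambda>t. \<bar>?h \<theta> t - ?h \<theta>' t\<bar>) \<le> expectation (\<lambda>t. pi * \<bar>\<theta> - \<theta>'\<bar>)"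
    proof (intro integral_mono)
      show "integrable \<nu> (\<lambda>t. \<bar>?h \<theta> t - ?h \<theta>' t\<bar>)" using int by simp
      show "\<bar>?h \<theta> t - ?h \<theta>' t\<bar> \<le> pi * \<bar>\<theta> - \<theta>'\<bar>" for t
        using half_sq_angle_dist_Lipschitz[of "-\<theta>" "-t" "-\<theta>'"] by (simp add: abs_minus_commute)
    qed simp
    then show ?thesis by (simp add: prob_space)
  qed
  ultimately show ?thesis by linarith
qed

lemma continuous_on_cost: "continuous_on A cost"
  by (rule continuous_on_subset[OF _ subset_UNIV], rule lipschitz_on_continuous_on[of pi])
     (auto simp: lipschitz_on_def dist_real_def cost_Lipschitz)

lemma cost_overshoot:
  assumes "\<bar>\<theta>\<bar> \<le> pi"
  shows "cost \<theta> = 1 / 2 * expectation (\<lambda>t. (t - \<theta>)\<^sup>2) - 2 * pi * expectation (overshoot \<theta>)"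
proof -
  have "cost \<theta> = 1 / 2 * expectation (\<lambda>t. (t - \<theta>)\<^sup>2 - 4 * pi * overshoot \<theta> t)"
    unfolding cost_def
  proof (intro arg_cong[of _ _ "(*) (1 / 2)"] integral_cong_AE)
    show "AE t in \<nu>. (angle_dist (t - \<theta>))\<^sup>2 = (t - \<theta>)\<^sup>2 - 4 * pi * overshoot \<theta> t"
      using support
    proof eventually_elim
      case (elim t)
      then have "\<bar>t - \<theta>\<bar> \<le> 2 * pi" using assms by linarith
      then show ?case by (simp add: angle_dist_sq_wrapped overshoot_def)
    qed
  qed (auto simp: overshoot_def)
  also have "\<dots> = 1 / 2 * (expectation (\<lambda>t. (t - \<theta>)\<^sup>2) - 4 * pi * expectation (overshoot \<theta>))"
    by (subst Bochner_Integration.integral_diff) (auto intro!: integrable_continuous continuous_intros)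
  finally show ?thesis by (simp add: algebra_simps)
qed

lemma expectation_sq_dev:
  "expectation (\<lambda>t. (t - \<theta>)\<^sup>2) = expectation (\<lambda>t. t\<^sup>2) - 2 * \<theta> * mean + \<theta>\<^sup>2"
proof -
  have int: "integrable \<nu> (\<lambda>t. t\<^sup>2)" "integrable \<nu> (\<lambda>t. t)"
    by (intro integrable_continuous continuous_intros)+
  have "expectation (\<lambda>t. (t - \<theta>)\<^sup>2) = expectation (\<lambda>t. t\<^sup>2 - 2 * \<theta> * t + \<theta>\<^sup>2)"
    by (simp add: power2_diff algebra_simps)
  also have "\<dots> = expectation (\<lambda>t. t\<^sup>2) - 2 * \<theta> * mean + \<theta>\<^sup>2"
    using int by (simp add: prob_space)
  finally show ?thesis .
qed

text \<open>
  The squared deviation is strongly convex with modulus \<open>1\<close>. The overshoot term is subtracted, so it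
  costs convexity, but for the uniform law it costs exactly all of it (\<open>integral_overshoot\<close>), and
  here the relevant density is at most the fraction \<open>1 - \<alpha>\<close> of the uniform one: the modulus \<open>\<alpha>\<close> is
  left. The restriction \<open>\<pi> - \<phi>\<close> on the angles keeps their antipodes out of the central arc, where
  the density is not controlled.
\<close>

lemma cost_strongly_convex:
  assumes ab: "\<bar>a\<bar> \<le> pi - \<phi>" "\<bar>b\<bar> \<le> pi - \<phi>" and eps: "0 \<le> \<epsilon>" "\<epsilon> \<le> 1"
  shows "cost ((1 - \<epsilon>) * a + \<epsilon> * b)
    \<le> (1 - \<epsilon>) * cost a + \<epsilon> * cost b - \<alpha> / 2 * \<epsilon> * (1 - \<epsilon>) * (a - b)\<^sup>2"
proof -
  define c where "c = (1 - \<epsilon>) * a + \<epsilon> * b"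
  have "\<bar>c\<bar> \<le> (1 - \<epsilon>) * \<bar>a\<bar> + \<epsilon> * \<bar>b\<bar>"
    using eps unfolding c_def by (intro order_trans[OF abs_triangle_ineq]) (simp add: abs_mult)
  also have "\<dots> \<le> (1 - \<epsilon>) * (pi - \<phi>) + \<epsilon> * (pi - \<phi>)"
    using ab eps by (intro add_mono mult_left_mono) auto
  finally have c: "\<bar>c\<bar> \<le> pi - \<phi>" by (simp add: algebra_simps)
  define h where "h = (\<lambda>t. (1 - \<epsilon>) * overshoot a t + \<epsilon> * overshoot b t - overshoot c t)"
  have h_cont: "continuous_on UNIV h"
    unfolding h_def by (intro continuous_intros)
  have int: "integrable \<nu> (overshoot \<theta>)" for \<theta>
    by (intro integrable_continuous continuous_intros)
  have "expectation h \<le> (1 - \<alpha>) / (2 * pi) * integral {-pi..pi} h"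
  proof (rule tail_dominated[OF h_cont])
    show "0 \<le> h t" for t
      using overshoot_convex[OF eps, of a b t] by (simp add: h_def c_def)
    show "h t = 0" if "\<bar>t\<bar> < \<phi>" for t
      using that ab c by (auto simp: h_def overshoot_def)
  qed
  also have "integral {-pi..pi} h = (1 - \<epsilon>) * (a\<^sup>2 / 2) + \<epsilon> * (b\<^sup>2 / 2) - c\<^sup>2 / 2"
    using ab c phi unfolding h_def
    by (intro integral_unique has_integral_diff has_integral_add has_integral_mult_right integral_overshoot) auto
  also have "\<dots> = \<epsilon> * (1 - \<epsilon>) * (a - b)\<^sup>2 / 2"
    by (simp add: c_def power2_eq_square field_simps)
  finally have le: "2 * pi * expectation h \<le> (1 - \<alpha>) * (\<epsilon> * (1 - \<epsilon>) * (a - b)\<^sup>2 / 2)"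
    by (simp add: field_simps)
  have Eh: "expectation h = (1 - \<epsilon>) * expectation (overshoot a) + \<epsilon> * expectation (overshoot b)
       - expectation (overshoot c)"
    using int by (simp add: h_def)
  have cost_eq: "cost \<theta> = 1 / 2 * (expectation (\<lambda>t. t\<^sup>2) - 2 * \<theta> * mean + \<theta>\<^sup>2) - 2 * pi * expectation (overshoot \<theta>)"
    if "\<bar>\<theta>\<bar> \<le> pi - \<phi>" for \<theta>
    using that phi by (simp add: cost_overshoot expectation_sq_dev)
  have "(1 - \<epsilon>) * cost a + \<epsilon> * cost b - cost c = \<epsilon> * (1 - \<epsilon>) * (a - b)\<^sup>2 / 2 - 2 * pi * expectation h"
    unfolding cost_eq[OF ab(1)] cost_eq[OF ab(2)] cost_eq[OF c] Eh
    by (simp add: c_def power2_eq_square field_simps)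
  moreover have "(1 - \<alpha>) * (\<epsilon> * (1 - \<epsilon>) * (a - b)\<^sup>2 / 2)
      = \<epsilon> * (1 - \<epsilon>) * (a - b)\<^sup>2 / 2 - \<alpha> / 2 * \<epsilon> * (1 - \<epsilon>) * (a - b)\<^sup>2"
  proof -
    have "(1 - \<alpha>) * (y / 2) = y / 2 - \<alpha> / 2 * y" for y :: real by (simp add: field_simps)
    then show ?thesis by (simp only: mult.assoc)
  qed
  ultimately show ?thesis
    using le unfolding c_def[symmetric] by linarith
qed

text \<open>
  Quadratic growth of a strongly convex function at its minimum, obtained without derivatives by
  comparing with points on the segment close to \<open>\<tau>\<close>.
\<close>

lemma local_growth:
  assumes \<tau>: "\<bar>\<tau>\<bar> \<le> pi - \<phi>" and min: "\<And>\<theta>. \<bar>\<theta>\<bar> \<le> pi - \<phi> \<Longrightarrow> cost \<tau> \<le> cost \<theta>"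
    and \<theta>: "\<bar>\<theta>\<bar> \<le> pi - \<phi>"
  shows "\<alpha> / 2 * (\<theta> - \<tau>)\<^sup>2 \<le> cost \<theta> - cost \<tau>"
proof (rule field_le_epsilon)
  have key: "\<alpha> / 2 * (1 - \<epsilon>) * (\<theta> - \<tau>)\<^sup>2 \<le> cost \<theta> - cost \<tau>" if "0 < \<epsilon>" "\<epsilon> \<le> 1" for \<epsilon>
  proof -
    have "\<bar>(1 - \<epsilon>) * \<tau> + \<epsilon> * \<theta>\<bar> \<le> (1 - \<epsilon>) * \<bar>\<tau>\<bar> + \<epsilon> * \<bar>\<theta>\<bar>"
      using that by (intro order_trans[OF abs_triangle_ineq]) (simp add: abs_mult)
    also have "\<dots> \<le> (1 - \<epsilon>) * (pi - \<phi>) + \<epsilon> * (pi - \<phi>)"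
      using \<tau> \<theta> that by (intro add_mono mult_left_mono) auto
    finally have "cost \<tau> \<le> cost ((1 - \<epsilon>) * \<tau> + \<epsilon> * \<theta>)"
      by (intro min) (simp add: algebra_simps)
    also have "\<dots> \<le> (1 - \<epsilon>) * cost \<tau> + \<epsilon> * cost \<theta> - \<alpha> / 2 * \<epsilon> * (1 - \<epsilon>) * (\<tau> - \<theta>)\<^sup>2"
      using that by (intro cost_strongly_convex[OF \<tau> \<theta>]) auto
    finally have "\<epsilon> * (\<alpha> / 2 * (1 - \<epsilon>) * (\<theta> - \<tau>)\<^sup>2) \<le> \<epsilon> * (cost \<theta> - cost \<tau>)"
      by (simp add: algebra_simps power2_commute)
    then show ?thesis using that by simp
  qed
  fix e :: real assume e: "0 < e"
  define \<epsilon> where "\<epsilon> = min 1 (e / (\<alpha> / 2 * (\<theta> - \<tau>)\<^sup>2 + 1))"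
  have pos: "0 < \<alpha> / 2 * (\<theta> - \<tau>)\<^sup>2 + 1" using alpha by (intro add_nonneg_pos) auto
  have "0 < \<epsilon>" "\<epsilon> \<le> 1" using e pos by (auto simp: \<epsilon>_def)
  have "\<epsilon> * (\<alpha> / 2 * (\<theta> - \<tau>)\<^sup>2) \<le> \<epsilon> * (\<alpha> / 2 * (\<theta> - \<tau>)\<^sup>2 + 1)"
    using \<open>0 < \<epsilon>\<close> by (intro mult_left_mono) auto
  also have "\<dots> \<le> e / (\<alpha> / 2 * (\<theta> - \<tau>)\<^sup>2 + 1) * (\<alpha> / 2 * (\<theta> - \<tau>)\<^sup>2 + 1)"
    using pos by (intro mult_right_mono) (auto simp: \<epsilon>_def)
  also have "\<dots> = e" using pos by simp
  finally have "\<epsilon> * (\<alpha> / 2 * (\<theta> - \<tau>)\<^sup>2) \<le> e" .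
  moreover have "\<alpha> / 2 * (1 - \<epsilon>) * (\<theta> - \<tau>)\<^sup>2 = \<alpha> / 2 * (\<theta> - \<tau>)\<^sup>2 - \<epsilon> * (\<alpha> / 2 * (\<theta> - \<tau>)\<^sup>2)"
    by algebra
  ultimately show "\<alpha> / 2 * (\<theta> - \<tau>)\<^sup>2 \<le> cost \<theta> - cost \<tau> + e"
    using key[OF \<open>0 < \<epsilon>\<close> \<open>\<epsilon> \<le> 1\<close>] by linarith
qed

lemma cost_antipode:
  assumes "\<bar>a\<bar> \<le> \<phi>"
  shows "cost (a + pi) = 1 / 2 * expectation (\<lambda>t. (t - a)\<^sup>2) - pi * expectation (\<lambda>t. \<bar>t - a\<bar>) + pi\<^sup>2 / 2"
proof -
  have int: "integrable \<nu> (\<lambda>t. (t - a)\<^sup>2)" "integrable \<nu> (\<lambda>t. \<bar>t - a\<bar>)"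
    by (intro integrable_continuous continuous_intros)+
  have "cost (a + pi) = 1 / 2 * expectation (\<lambda>t. (t - a)\<^sup>2 - 2 * pi * \<bar>t - a\<bar> + pi\<^sup>2)"
    unfolding cost_def
  proof (intro arg_cong[of _ _ "(*) (1 / 2)"] integral_cong_AE)
    show "AE t in \<nu>. (angle_dist (t - (a + pi)))\<^sup>2 = (t - a)\<^sup>2 - 2 * pi * \<bar>t - a\<bar> + pi\<^sup>2"
      using support
    proof eventually_elim
      case (elim t)
      then have "\<bar>t - a\<bar> \<le> 2 * pi" using assms phi by linarith
      then have "angle_dist (t - a - pi) = \<bar>\<bar>t - a\<bar> - pi\<bar>" by (rule angle_dist_antipode)
      moreover have "t - a - pi = t - (a + pi)" by simp
      ultimately have "angle_dist (t - (a + pi)) = \<bar>\<bar>t - a\<bar> - pi\<bar>" by simp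
      then show ?case by (simp add: power2_diff)
    qed
  qed auto
  also have "\<dots> = 1 / 2 * expectation (\<lambda>t. (t - a)\<^sup>2) - pi * expectation (\<lambda>t. \<bar>t - a\<bar>) + pi\<^sup>2 / 2"
    using int by (simp add: prob_space algebra_simps)
  finally show ?thesis .
qed

lemma expectation_abs_dev_le:
  assumes "\<bar>a\<bar> \<le> \<phi>"
  shows "expectation (\<lambda>t. \<bar>t - a\<bar>) \<le> \<phi> - a / \<phi> * mean + 2 * tail_bound"
proof -
  have int: "integrable \<nu> (\<lambda>t. max 0 (t - \<phi>))" "integrable \<nu> (\<lambda>t. max 0 (- t - \<phi>))" "integrable \<nu> (\<lambda>t. t)"
    "integrable \<nu> (\<lambda>t. \<bar>t - a\<bar>)"
    by (intro integrable_continuous continuous_intros)+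
  have r: "- 1 \<le> a / \<phi>" "a / \<phi> \<le> 1" using assms phi by (auto simp: field_simps abs_le_iff)
  have "expectation (\<lambda>t. \<bar>t - a\<bar>)
      \<le> expectation (\<lambda>t. \<phi> - a / \<phi> * t + (1 + a / \<phi>) * max 0 (t - \<phi>) + (1 - a / \<phi>) * max 0 (- t - \<phi>))"
    using int assms phi chord_bound[of \<phi> a] by (intro integral_mono) auto
  also have "\<dots> = \<phi> - a / \<phi> * mean + (1 + a / \<phi>) * expectation (\<lambda>t. max 0 (t - \<phi>))
      + (1 - a / \<phi>) * expectation (\<lambda>t. max 0 (- t - \<phi>))"
    using int by (simp add: prob_space)
  also have "\<dots> \<le> \<phi> - a / \<phi> * mean + (1 + a / \<phi>) * tail_bound + (1 - a / \<phi>) * tail_bound"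
    using r positive_tail negative_tail by (intro add_mono mult_left_mono) auto
  also have "\<dots> = \<phi> - a / \<phi> * mean + 2 * tail_bound" by (simp add: algebra_simps)
  finally show ?thesis .
qed

text \<open>
  Points that are not covered by strong convexity are antipodes \<open>a + \<pi>\<close> of the central arc. Their
  cost is compared with half the variance, an upper bound for the minimal cost. By \<open>chord_bound\<close> the
  difference is controlled by the mean and the two tails; \<open>gamma_const\<close> is what this gives for mean \<open>0\<close>.
\<close>

lemma far_growth:
  assumes a: "\<bar>a\<bar> \<le> \<phi>"
  shows "gamma_const \<alpha> \<phi> - (pi - \<phi>) * \<bar>mean\<bar> \<le> cost (a + pi) - 1 / 2 * expectation (\<lambda>t. (t - mean)\<^sup>2)"
proof -
  define r where "r = a / \<phi>"
  have ar: "a = r * \<phi>" using phi by (simp add: r_def)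
  have r: "\<bar>r\<bar> \<le> 1" using a phi by (simp add: r_def)
  have "pi * expectation (\<lambda>t. \<bar>t - a\<bar>) \<le> pi * (\<phi> - r * mean + 2 * tail_bound)"
    using expectation_abs_dev_le[OF a] unfolding r_def by (intro mult_left_mono) auto
  also have "\<dots> = pi * \<phi> - pi * r * mean + (1 - \<alpha>) * (pi - \<phi>)\<^sup>2 / 2"
    by (simp add: tail_bound_def field_simps)
  finally have *: "pi * expectation (\<lambda>t. \<bar>t - a\<bar>) \<le> pi * \<phi> - pi * r * mean + (1 - \<alpha>) * (pi - \<phi>)\<^sup>2 / 2" .
  have "- ((pi - \<phi>) * \<bar>mean\<bar>) \<le> (pi - \<phi>) * (r * mean)"
  proof -
    have "\<bar>r * mean\<bar> \<le> 1 * \<bar>mean\<bar>" unfolding abs_mult using r by (intro mult_right_mono) auto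
    then have "- \<bar>mean\<bar> \<le> r * mean" by linarith
    then have "(pi - \<phi>) * (- \<bar>mean\<bar>) \<le> (pi - \<phi>) * (r * mean)" using phi by (intro mult_left_mono) auto
    then show ?thesis by simp
  qed
  also have "\<dots> \<le> (pi - \<phi>) * (r * mean) + 1 / 2 * a\<^sup>2 + 1 / 2 * mean\<^sup>2" by simp
  also have "\<dots> = 1 / 2 * (a - mean)\<^sup>2 + pi * r * mean"
    by (simp add: ar power2_eq_square algebra_simps)
  finally have "- ((pi - \<phi>) * \<bar>mean\<bar>) \<le> 1 / 2 * (a - mean)\<^sup>2 + pi * r * mean" .
  moreover have "1 / 2 * expectation (\<lambda>t. (t - a)\<^sup>2) - 1 / 2 * expectation (\<lambda>t. (t - mean)\<^sup>2) = 1 / 2 * (a - mean)\<^sup>2"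
    unfolding expectation_sq_dev by (simp add: power2_eq_square algebra_simps)
  moreover have "pi\<^sup>2 / 2 - pi * \<phi> - (1 - \<alpha>) * (pi - \<phi>)\<^sup>2 / 2 = gamma_const \<alpha> \<phi>"
    by (simp add: gamma_const_def power2_eq_square field_simps)
  ultimately show ?thesis
    using * cost_antipode[OF a] by simp
qed

text \<open>
  The minimum over the arc of strong convexity is a global one, because the cost on the complementary arc
  exceeds the cost at the mean by at least \<open>gamma_const / 8\<close>. Both kinds of growth are weakened to a
  common multiple of the squared distance; \<open>\<pi>\<^sup>2\<close> bounds that square.
\<close>

lemma unique_min_growth:
  assumes gap: "(pi - \<phi>) * (\<phi> + tail_bound) \<le> 7 / 8 * gamma_const \<alpha> \<phi>"
    and gamma: "0 < gamma_const \<alpha> \<phi>"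
  obtains \<tau> where "\<And>\<theta>. gamma_const \<alpha> \<phi> / (8 * pi\<^sup>2) * (angle_dist (\<theta> - \<tau>))\<^sup>2 \<le> cost \<theta> - cost \<tau>"
proof -
  let ?J = "{- (pi - \<phi>)..pi - \<phi>}"
  obtain \<tau> where "\<tau> \<in> ?J" "\<forall>\<theta>\<in>?J. cost \<tau> \<le> cost \<theta>"
    using continuous_attains_inf[of ?J cost] continuous_on_cost phi by auto
  then have \<tau>: "\<bar>\<tau>\<bar> \<le> pi - \<phi>" and min: "\<And>\<theta>. \<bar>\<theta>\<bar> \<le> pi - \<phi> \<Longrightarrow> cost \<tau> \<le> cost \<theta>"
    by (auto simp: abs_le_iff)
  have gamma_le: "gamma_const \<alpha> \<phi> \<le> \<alpha> / 2 * (pi - \<phi>)\<^sup>2"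
    by (simp add: gamma_const_def)
  also have "\<dots> \<le> 1 / 2 * (pi - \<phi>)\<^sup>2"
    using alpha by (intro mult_right_mono) auto
  finally have g: "gamma_const \<alpha> \<phi> \<le> 1 / 2 * (pi - \<phi>)\<^sup>2" .
  have "(pi - \<phi>) * \<bar>mean\<bar> \<le> (pi - \<phi>) * (\<phi> + tail_bound)"
    using abs_mean_le phi by (intro mult_left_mono) auto
  also note gap
  finally have mean_gap: "(pi - \<phi>) * \<bar>mean\<bar> \<le> 7 / 8 * gamma_const \<alpha> \<phi>" .
  also have "\<dots> \<le> (pi - \<phi>) * (pi - \<phi>)"
    using g gamma by (simp add: power2_eq_square)
  finally have mean_J: "\<bar>mean\<bar> \<le> pi - \<phi>" using phi by simp
  have "cost \<tau> \<le> cost mean" by (rule min[OF mean_J])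
  also have "\<dots> \<le> 1 / 2 * expectation (\<lambda>t. (t - mean)\<^sup>2)"
    unfolding cost_def
  proof (intro mult_left_mono integral_mono)
    show "(angle_dist (t - mean))\<^sup>2 \<le> (t - mean)\<^sup>2" for t
      using power_mono[OF angle_dist_le_abs angle_dist_nonneg, of "t - mean" 2] by simp
  qed (auto intro!: integrable_continuous continuous_intros)
  finally have cost_\<tau>: "cost \<tau> \<le> 1 / 2 * expectation (\<lambda>t. (t - mean)\<^sup>2)" .
  have far: "gamma_const \<alpha> \<phi> / 8 \<le> cost (a + pi) - cost \<tau>" if "\<bar>a\<bar> \<le> \<phi>" for a
    using far_growth[OF that] mean_gap cost_\<tau> by linarith
  have periodic: "cost (\<theta> + 2 * pi * real_of_int k) = cost \<theta>" for \<theta> k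
  proof -
    have "angle_dist (t - (\<theta> + 2 * pi * real_of_int k)) = angle_dist (t - \<theta>)" for t
      using angle_dist_add_2pi_int[of "t - (\<theta> + 2 * pi * real_of_int k)" k] by (simp add: algebra_simps)
    then show ?thesis by (simp add: cost_def)
  qed
  have core: "gamma_const \<alpha> \<phi> / (8 * pi\<^sup>2) * (angle_dist (\<theta> - \<tau>))\<^sup>2 \<le> cost \<theta> - cost \<tau>"
    if \<theta>: "- pi \<le> \<theta>" "\<theta> < pi" for \<theta>
  proof (cases "\<bar>\<theta>\<bar> \<le> pi - \<phi>")
    case True
    have "(angle_dist (\<theta> - \<tau>))\<^sup>2 \<le> (\<theta> - \<tau>)\<^sup>2"
      using power_mono[OF angle_dist_le_abs angle_dist_nonneg, of "\<theta> - \<tau>" 2] by simp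
    moreover have "gamma_const \<alpha> \<phi> / (8 * pi\<^sup>2) \<le> \<alpha> / 2"
    proof -
      have "(pi - \<phi>)\<^sup>2 \<le> pi\<^sup>2" using phi by (intro power_mono) auto
      then have "\<alpha> / 2 * (pi - \<phi>)\<^sup>2 \<le> \<alpha> / 2 * (8 * pi\<^sup>2)"
        using alpha zero_le_power2[of pi] by (intro mult_left_mono) linarith+
      with gamma_le show ?thesis by (simp add: field_simps)
    qed
    ultimately have "gamma_const \<alpha> \<phi> / (8 * pi\<^sup>2) * (angle_dist (\<theta> - \<tau>))\<^sup>2 \<le> \<alpha> / 2 * (\<theta> - \<tau>)\<^sup>2"
      using gamma alpha by (intro mult_mono) auto
    also have "\<dots> \<le> cost \<theta> - cost \<tau>" by (rule local_growth[OF \<tau> min True])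
    finally show ?thesis .
  next
    case False
    have "(angle_dist (\<theta> - \<tau>))\<^sup>2 \<le> pi\<^sup>2"
      using power_mono[OF angle_dist_le_pi angle_dist_nonneg, of "\<theta> - \<tau>" 2] by simp
    then have "gamma_const \<alpha> \<phi> / (8 * pi\<^sup>2) * (angle_dist (\<theta> - \<tau>))\<^sup>2 \<le> gamma_const \<alpha> \<phi> / (8 * pi\<^sup>2) * pi\<^sup>2"
      using gamma by (intro mult_left_mono) auto
    also have "\<dots> = gamma_const \<alpha> \<phi> / 8" by simp
    also have "\<dots> \<le> cost \<theta> - cost \<tau>"
    proof (cases "\<theta> > 0")
      case True
      then show ?thesis using far[of "\<theta> - pi"] False \<theta> by simp
    next
      case f: False
      have "cost (\<theta> + pi + pi) = cost \<theta>" using periodic[of \<theta> 1] by (simp add: algebra_simps)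
      then show ?thesis using far[of "\<theta> + pi"] False f \<theta> by simp
    qed
    finally show ?thesis .
  qed
  show thesis
  proof (rule that[of \<tau>])
    fix \<theta> :: real
    obtain t where t: "- pi \<le> t" "t < pi" "circ \<theta> = circ t"
      using S1_obtain_angle[of "circ \<theta>"] by auto
    then obtain k where k: "\<theta> = t + 2 * pi * real_of_int k"
      using sin_cos_eq_iff[of \<theta> t] by (auto simp: algebra_simps circ_def)
    have "angle_dist (\<theta> - \<tau>) = angle_dist (t - \<tau>)"
      using angle_dist_add_2pi_int[of "t - \<tau>" k] by (simp add: k algebra_simps)
    moreover have "cost \<theta> = cost t" by (simp add: k periodic)
    ultimately show "gamma_const \<alpha> \<phi> / (8 * pi\<^sup>2) * (angle_dist (\<theta> - \<tau>))\<^sup>2 \<le> cost \<theta> - cost \<tau>"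
      using core[OF t(1,2)] by simp
  qed
qed

end

section \<open>Uniform deviations of empirical means of Lipschitz functions\<close>

text \<open>
  The exponential moment behind Hoeffding's inequality. The tail bound would not suffice here, since
  averages over many thresholds have to be controlled without a union bound.
\<close>

lemma (in prob_space) exp_moment_centered_sum_le:
  fixes Y :: "'i \<Rightarrow> 'a \<Rightarrow> real"
  assumes I: "finite I" and indep: "indep_vars (\<lambda>_. borel) Y I"
    and Y: "\<And>i \<omega>. i \<in> I \<Longrightarrow> a \<le> Y i \<omega> \<and> Y i \<omega> \<le> a + 1" and l: "0 < l"
  shows "(\<integral>\<^sup>+\<omega>. ennreal (exp (l * (\<Sum>i\<in>I. Y i \<omega> - expectation (Y i)))) \<partial>M)
    \<le> ennreal (exp (l\<^sup>2 * card I / 8))"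
proof -
  have "(\<integral>\<^sup>+\<omega>. ennreal (exp (l * (\<Sum>i\<in>I. Y i \<omega> - expectation (Y i)))) \<partial>M)
      = (\<integral>\<^sup>+\<omega>. (\<Prod>i\<in>I. ennreal (exp (l * (Y i \<omega> - expectation (Y i))))) \<partial>M)"
    using I by (intro nn_integral_cong) (simp add: sum_distrib_left exp_sum prod_ennreal)
  also have "\<dots> = (\<Prod>i\<in>I. \<integral>\<^sup>+\<omega>. ennreal (exp (l * (Y i \<omega> - expectation (Y i)))) \<partial>M)"
    using I by (intro indep_vars_nn_integral indep_vars_compose2[OF indep]) auto
  also have "\<dots> \<le> (\<Prod>i\<in>I. ennreal (exp (l\<^sup>2 / 8)))"
  proof (intro prod_mono_ennreal)
    fix i assume i: "i \<in> I"
    have "random_variable borel (Y i)" using indep i by (simp add: indep_vars_def)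
    then interpret interval_bounded_random_variable M "Y i" a "a + 1"
      using Y[OF i] by unfold_locales auto
    show "(\<integral>\<^sup>+\<omega>. ennreal (exp (l * (Y i \<omega> - expectation (Y i)))) \<partial>M) \<le> ennreal (exp (l\<^sup>2 / 8))"
      using Hoeffdings_lemma_nn_integral[OF l] by simp
  qed
  also have "\<dots> = ennreal (exp (l\<^sup>2 * card I / 8))"
    using I by (simp add: prod_ennreal ennreal_power flip: exp_of_nat_mult)
  finally show ?thesis .
qed

lemma (in prob_space) exp_moment_abs_centered_sum_le:
  fixes Y :: "'i \<Rightarrow> 'a \<Rightarrow> real"
  assumes I: "finite I" and indep: "indep_vars (\<lambda>_. borel) Y I"
    and Y: "\<And>i \<omega>. i \<in> I \<Longrightarrow> 0 \<le> Y i \<omega> \<and> Y i \<omega> \<le> 1" and l: "0 < l"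
  shows "(\<integral>\<^sup>+\<omega>. ennreal (exp (l * \<bar>\<Sum>i\<in>I. Y i \<omega> - expectation (Y i)\<bar>)) \<partial>M)
    \<le> ennreal (2 * exp (l\<^sup>2 * card I / 8))"
proof -
  have [measurable]: "random_variable borel (Y i)" if "i \<in> I" for i
    using indep that by (simp add: indep_vars_def)
  let ?S = "\<lambda>\<omega>. \<Sum>i\<in>I. Y i \<omega> - expectation (Y i)"
  have 1: "(\<integral>\<^sup>+\<omega>. ennreal (exp (l * ?S \<omega>)) \<partial>M) \<le> ennreal (exp (l\<^sup>2 * card I / 8))"
    using Y by (intro exp_moment_centered_sum_le[OF I indep _ l, of 0]) auto
  have "indep_vars (\<lambda>_. borel) (\<lambda>i \<omega>. - Y i \<omega>) I"
    by (rule indep_vars_compose2[OF indep]) auto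
  then have "(\<integral>\<^sup>+\<omega>. ennreal (exp (l * (\<Sum>i\<in>I. - Y i \<omega> - expectation (\<lambda>\<omega>. - Y i \<omega>)))) \<partial>M)
      \<le> ennreal (exp (l\<^sup>2 * card I / 8))"
    using Y by (intro exp_moment_centered_sum_le[OF I _ _ l, of _ "-1"]) auto
  moreover have "(\<Sum>i\<in>I. - Y i \<omega> - expectation (\<lambda>\<omega>. - Y i \<omega>)) = - ?S \<omega>" for \<omega>
    by (simp add: sum_negf[symmetric])
  ultimately have 2: "(\<integral>\<^sup>+\<omega>. ennreal (exp (l * - ?S \<omega>)) \<partial>M) \<le> ennreal (exp (l\<^sup>2 * card I / 8))"
    by (simp only:)
  have "(\<integral>\<^sup>+\<omega>. ennreal (exp (l * \<bar>?S \<omega>\<bar>)) \<partial>M)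
      \<le> (\<integral>\<^sup>+\<omega>. ennreal (exp (l * ?S \<omega>)) + ennreal (exp (l * - ?S \<omega>)) \<partial>M)"
    by (intro nn_integral_mono) (auto simp: abs_if simp flip: ennreal_plus)
  also have "\<dots> = (\<integral>\<^sup>+\<omega>. ennreal (exp (l * ?S \<omega>)) \<partial>M) + (\<integral>\<^sup>+\<omega>. ennreal (exp (l * - ?S \<omega>)) \<partial>M)"
    by (intro nn_integral_add) auto
  also have "\<dots> \<le> ennreal (exp (l\<^sup>2 * card I / 8)) + ennreal (exp (l\<^sup>2 * card I / 8))"
    by (intro add_mono 1 2)
  also have "\<dots> = ennreal (2 * exp (l\<^sup>2 * card I / 8))"
    by (simp flip: ennreal_plus)
  finally show ?thesis .
qed

text \<open>
  Averaging over \<open>J\<close> does not worsen the two-sided Hoeffding bound, whatever the dependence between the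
  families and however large \<open>J\<close> is: by convexity the exponential moment of the average is at most the
  average of the exponential moments.
\<close>

lemma (in prob_space) averaged_deviation_tail:
  fixes Y :: "'j \<Rightarrow> 'i \<Rightarrow> 'a \<Rightarrow> real" and x :: real
  assumes I: "finite I" "I \<noteq> {}" and J: "finite J" "J \<noteq> {}"
    and indep: "\<And>j. j \<in> J \<Longrightarrow> indep_vars (\<lambda>_. borel) (Y j) I"
    and Y: "\<And>j i \<omega>. j \<in> J \<Longrightarrow> i \<in> I \<Longrightarrow> 0 \<le> Y j i \<omega> \<and> Y j i \<omega> \<le> 1" and x: "0 < x"
  shows "prob {\<omega> \<in> space M. sqrt (card I * x / 2) \<le>
      (\<Sum>j\<in>J. \<bar>\<Sum>i\<in>I. Y j i \<omega> - expectation (Y j i)\<bar>) / card J} \<le> 2 * exp (- x)"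
proof -
  have [measurable]: "random_variable borel (Y j i)" if "j \<in> J" "i \<in> I" for j i
    using indep that by (simp add: indep_vars_def)
  define n where "n = real (card I)"
  define t where "t = sqrt (n * x / 2)"
  \<comment> \<open>The minimizer of the exponent \<open>l\<^sup>2 n / 8 - l t\<close>.\<close>
  define l where "l = 4 * t / n"
  define D where "D = (\<lambda>\<omega>. (\<Sum>j\<in>J. \<bar>\<Sum>i\<in>I. Y j i \<omega> - expectation (Y j i)\<bar>) / card J)"
  have n: "n > 0" using I by (simp add: n_def card_gt_0_iff)
  have t: "t > 0" using n x by (simp add: t_def)
  have l: "l > 0" using n t by (simp add: l_def)
  have cJ: "real (card J) > 0" using J by (simp add: card_gt_0_iff)
  have [measurable]: "D \<in> borel_measurable M" unfolding D_def by measurable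
  have jensen: "exp (l * D \<omega>) \<le> (\<Sum>j\<in>J. exp (l * \<bar>\<Sum>i\<in>I. Y j i \<omega> - expectation (Y j i)\<bar>)) / card J" for \<omega>
  proof -
    have "exp (l * (\<Sum>j\<in>J. (1 / card J) *\<^sub>R \<bar>\<Sum>i\<in>I. Y j i \<omega> - expectation (Y j i)\<bar>))
        \<le> (\<Sum>j\<in>J. (1 / card J) * exp (l * \<bar>\<Sum>i\<in>I. Y j i \<omega> - expectation (Y j i)\<bar>))"
      using J l cJ by (intro convex_on_sum[OF _ _ convex_on_exp]) auto
    then show ?thesis by (simp add: D_def sum_divide_distrib)
  qed
  have "(\<integral>\<^sup>+\<omega>. ennreal (exp (l * D \<omega>)) \<partial>M)
      \<le> (\<integral>\<^sup>+\<omega>. ennreal (1 / card J) * (\<Sum>j\<in>J. ennreal (exp (l * \<bar>\<Sum>i\<in>I. Y j i \<omega> - expectation (Y j i)\<bar>))) \<partial>M)"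
    using jensen by (intro nn_integral_mono) (simp add: sum_ennreal sum_nonneg flip: ennreal_mult)
  also have "\<dots> = ennreal (1 / card J) * (\<Sum>j\<in>J. \<integral>\<^sup>+\<omega>. ennreal (exp (l * \<bar>\<Sum>i\<in>I. Y j i \<omega> - expectation (Y j i)\<bar>)) \<partial>M)"
    by (subst nn_integral_cmult) (auto simp: nn_integral_sum simp del: sum_ennreal)
  also have "\<dots> \<le> ennreal (1 / card J) * (\<Sum>j\<in>J. ennreal (2 * exp (l\<^sup>2 * n / 8)))"
    using Y unfolding n_def
    by (intro mult_left_mono sum_mono exp_moment_abs_centered_sum_le I indep l) auto
  also have "\<dots> = ennreal (1 / card J) * (ennreal (card J) * ennreal (2 * exp (l\<^sup>2 * n / 8)))"
    by (simp add: ennreal_of_nat_eq_real_of_nat)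
  also have "\<dots> = ennreal (2 * exp (l\<^sup>2 * n / 8))"
    using cJ by (simp flip: ennreal_mult mult.assoc)
  finally have mgf: "(\<integral>\<^sup>+\<omega>. ennreal (exp (l * D \<omega>)) \<partial>M) \<le> ennreal (2 * exp (l\<^sup>2 * n / 8))" .
  have "emeasure M {\<omega> \<in> space M. t \<le> D \<omega>}
      \<le> ennreal (exp (- l * t)) * (\<integral>\<^sup>+\<omega>\<in>space M. ennreal (exp (l * D \<omega>)) \<partial>M)"
    by (intro Chernoff_ineq_nn_integral_ge l) auto
  also have "(\<integral>\<^sup>+\<omega>\<in>space M. ennreal (exp (l * D \<omega>)) \<partial>M) = (\<integral>\<^sup>+\<omega>. ennreal (exp (l * D \<omega>)) \<partial>M)"
    by (intro nn_integral_cong) simp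
  also have "ennreal (exp (- l * t)) * \<dots> \<le> ennreal (exp (- l * t)) * ennreal (2 * exp (l\<^sup>2 * n / 8))"
    by (intro mult_left_mono mgf) simp
  also have "\<dots> = ennreal (2 * exp (l\<^sup>2 * n / 8 - l * t))"
  proof -
    have "exp (- l * t) * (2 * exp A) = 2 * exp (A - l * t)" for A
      by (simp only: mult_minus_left exp_minus exp_diff divide_inverse) (simp only: mult_ac)
    then show ?thesis by (simp only: ennreal_mult[symmetric] exp_ge_zero mult_nonneg_nonneg zero_le_numeral)
  qed
  also have "l\<^sup>2 * n / 8 - l * t = - x"
  proof -
    have "t * t = n * x / 2" using n x by (simp add: t_def)
    then have "l\<^sup>2 * n / 8 - l * t = - 2 * (n * x / 2) / n"
      using n by (simp add: l_def power2_eq_square field_simps)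
    then show ?thesis using n by simp
  qed
  finally have "prob {\<omega> \<in> space M. t \<le> D \<omega>} \<le> 2 * exp (- x)"
    by (simp add: emeasure_eq_measure)
  then show ?thesis by (simp only: D_def t_def n_def)
qed

text \<open>
  A Lipschitz function on \<open>[-\<pi>, \<pi>]\<close> is nearly a combination of indicators of half-lines, with
  coefficients at most the Lipschitz constant times the mesh.
\<close>

definition grid :: "nat \<Rightarrow> nat \<Rightarrow> real" where
  "grid N j = - pi + 2 * pi * real j / real N"

definition step_approx :: "nat \<Rightarrow> (real \<Rightarrow> real) \<Rightarrow> real \<Rightarrow> real" where
  "step_approx N \<zeta> t = \<zeta> pi - (\<Sum>j<N. (\<zeta> (grid N (Suc j)) - \<zeta> (grid N j)) * (if t < grid N (Suc j) then 1 else 0))"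

lemma step_approx_error:
  assumes N: "N > 0" and t: "\<bar>t\<bar> \<le> pi"
    and lip: "\<And>s t. \<bar>\<zeta> s - \<zeta> t\<bar> \<le> L * \<bar>s - t\<bar>" and L: "0 \<le> L"
  shows "\<bar>\<zeta> t - step_approx N \<zeta> t\<bar> \<le> L * (2 * pi / N)"
proof -
  define y where "y = (t + pi) * N / (2 * pi)"
  define i where "i = nat \<lfloor>y\<rfloor>"
  have y: "0 \<le> y" "y \<le> N"
  proof -
    show "0 \<le> y" using t by (simp add: y_def abs_le_iff)
    have "(t + pi) * N \<le> (2 * pi) * N" using t by (intro mult_right_mono) auto
    then show "y \<le> N" by (simp add: y_def field_simps)
  qed
  have i: "real i \<le> y" "y < real i + 1" using y by (auto simp: i_def)
  have iN: "i \<le> N" using i y by linarith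
  have t_eq: "t = - pi + 2 * pi * y / N" using N by (simp add: y_def field_simps)
  have below: "t < grid N (Suc j) \<longleftrightarrow> i \<le> j" for j
  proof -
    have "t < grid N (Suc j) \<longleftrightarrow> y < real (Suc j)"
      using N by (simp add: t_eq grid_def divide_less_cancel mult_less_cancel_left linorder_not_le[THEN iffD2, OF pi_gt_zero])
    also have "\<dots> \<longleftrightarrow> i \<le> j" using i by linarith
    finally show ?thesis .
  qed
  have "(\<Sum>j<N. (\<zeta> (grid N (Suc j)) - \<zeta> (grid N j)) * (if t < grid N (Suc j) then 1 else 0))
      = (\<Sum>j<N. if i \<le> j then \<zeta> (grid N (Suc j)) - \<zeta> (grid N j) else 0)"
    by (intro sum.cong) (auto simp: below)
  also have "\<dots> = (\<Sum>j\<in>{i..<N}. \<zeta> (grid N (Suc j)) - \<zeta> (grid N j))"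
    by (subst sum.inter_filter[symmetric]) (auto intro!: sum.cong)
  also have "\<dots> = \<zeta> (grid N N) - \<zeta> (grid N i)"
    using iN by (rule sum_Suc_diff')
  also have "grid N N = pi" using N by (simp add: grid_def)
  finally have "step_approx N \<zeta> t = \<zeta> (grid N i)" by (simp add: step_approx_def)
  then have "\<bar>\<zeta> t - step_approx N \<zeta> t\<bar> \<le> L * \<bar>t - grid N i\<bar>" using lip by simp
  also have "\<dots> \<le> L * (2 * pi / N)"
  proof (intro mult_left_mono L)
    have "t - grid N i = 2 * pi / N * (y - i)"
      by (simp add: t_eq grid_def right_diff_distrib diff_divide_distrib)
    moreover have "2 * pi / N * (y - i) \<le> 2 * pi / N * 1" "0 \<le> 2 * pi / N * (y - i)"
      using i by (intro mult_left_mono mult_nonneg_nonneg; simp)+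
    ultimately show "\<bar>t - grid N i\<bar> \<le> 2 * pi / N" by simp
  qed
  finally show ?thesis .
qed

text \<open>
  Divided by the sample size, this says that the empirical mean of a Lipschitz function deviates from its expectation by at most \<open>L\<close> times the
  \<open>L\<^sup>1\<close>-distance between the empirical and the true distribution function, here as a Riemann
  sum with a discretisation error. The sum on the right does not involve \<open>\<zeta>\<close>, so the
  bound is uniform over all \<open>L\<close>-Lipschitz functions.
\<close>

lemma (in prob_space) Lipschitz_deviation_le:
  fixes T :: "'i \<Rightarrow> 'a \<Rightarrow> real"
  assumes I: "finite I" and T [measurable]: "\<And>i. i \<in> I \<Longrightarrow> random_variable borel (T i)"
    and bound: "\<And>i \<omega>. i \<in> I \<Longrightarrow> \<omega> \<in> space M \<Longrightarrow> \<bar>T i \<omega>\<bar> \<le> pi"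
    and lip: "\<And>s t. \<bar>\<zeta> s - \<zeta> t\<bar> \<le> L * \<bar>s - t\<bar>" and L: "0 \<le> L"
    and N: "N > 0" and \<omega>: "\<omega> \<in> space M"
  shows "\<bar>\<Sum>i\<in>I. \<zeta> (T i \<omega>) - expectation (\<lambda>\<omega>. \<zeta> (T i \<omega>))\<bar>
    \<le> L * (2 * pi / N) * (\<Sum>j<N. \<bar>\<Sum>i\<in>I. (if T i \<omega> < grid N (Suc j) then 1 else 0)
          - expectation (\<lambda>\<omega>. if T i \<omega> < grid N (Suc j) then 1 else 0)\<bar>)
       + card I * (2 * (L * (2 * pi / N)))"
proof -
  define e where "e = L * (2 * pi / N)"
  define b where "b = (\<lambda>j i \<omega>. if T i \<omega> < grid N (Suc j) then 1 else 0 :: real)"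
  define c where "c = (\<lambda>j. \<zeta> (grid N (Suc j)) - \<zeta> (grid N j))"
  have "continuous_on UNIV \<zeta>"
    using lip L by (intro lipschitz_on_continuous_on[of L]) (auto simp: lipschitz_on_def dist_real_def)
  then have [measurable]: "\<zeta> \<in> borel_measurable borel" by (rule borel_measurable_continuous_onI)
  have [measurable]: "b j i \<in> borel_measurable M" if "i \<in> I" for i j
    using that unfolding b_def by measurable
  have step: "step_approx N \<zeta> (T i \<omega>) = \<zeta> pi - (\<Sum>j<N. c j * b j i \<omega>)" for i \<omega>
    by (simp add: step_approx_def b_def c_def)
  have int_b: "integrable M (b j i)" if "i \<in> I" for i j
    using that by (intro integrable_const_bound[of _ 1]) (auto simp: b_def)
  have int_z: "integrable M (\<lambda>\<omega>. \<zeta> (T i \<omega>))" if "i \<in> I" for i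
  proof (intro integrable_const_bound[of _ "\<bar>\<zeta> 0\<bar> + L * pi"])
    show "AE \<omega> in M. norm (\<zeta> (T i \<omega>)) \<le> \<bar>\<zeta> 0\<bar> + L * pi"
    proof (rule AE_I2)
      fix \<omega> assume "\<omega> \<in> space M"
      then have "L * \<bar>T i \<omega> - 0\<bar> \<le> L * pi" using bound[OF that] L by (intro mult_left_mono) auto
      then show "norm (\<zeta> (T i \<omega>)) \<le> \<bar>\<zeta> 0\<bar> + L * pi" using lip[of "T i \<omega>" 0] by simp
    qed
  qed (use that in measurable)
  have err: "\<bar>\<zeta> (T i \<omega>) - step_approx N \<zeta> (T i \<omega>)\<bar> \<le> e" if "i \<in> I" "\<omega> \<in> space M" for i \<omega>
    unfolding e_def using N bound[OF that] lip L by (rule step_approx_error)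
  have int_s: "integrable M (\<lambda>\<omega>. step_approx N \<zeta> (T i \<omega>))" if "i \<in> I" for i
    unfolding step using int_b[OF that] by auto
  have Es: "expectation (\<lambda>\<omega>. step_approx N \<zeta> (T i \<omega>)) = \<zeta> pi - (\<Sum>j<N. c j * expectation (b j i))" if "i \<in> I" for i
    unfolding step using int_b[OF that] by (simp add: prob_space)
  have Eerr: "\<bar>expectation (\<lambda>\<omega>. \<zeta> (T i \<omega>)) - expectation (\<lambda>\<omega>. step_approx N \<zeta> (T i \<omega>))\<bar> \<le> e" if "i \<in> I" for i
  proof -
    have "\<bar>expectation (\<lambda>\<omega>. \<zeta> (T i \<omega>)) - expectation (\<lambda>\<omega>. step_approx N \<zeta> (T i \<omega>))\<bar>
        = \<bar>expectation (\<lambda>\<omega>. \<zeta> (T i \<omega>) - step_approx N \<zeta> (T i \<omega>))\<bar>"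
      using int_z[OF that] int_s[OF that] by simp
    also have "\<dots> \<le> expectation (\<lambda>\<omega>. \<bar>\<zeta> (T i \<omega>) - step_approx N \<zeta> (T i \<omega>)\<bar>)"
      by (rule integral_abs_bound)
    also have "\<dots> \<le> expectation (\<lambda>\<omega>. e)"
      using int_z[OF that] int_s[OF that] err[OF that] by (intro integral_mono) auto
    finally show ?thesis by (simp add: prob_space)
  qed
  have "\<bar>\<Sum>i\<in>I. \<zeta> (T i \<omega>) - expectation (\<lambda>\<omega>. \<zeta> (T i \<omega>))\<bar>
      \<le> \<bar>\<Sum>i\<in>I. step_approx N \<zeta> (T i \<omega>) - expectation (\<lambda>\<omega>. step_approx N \<zeta> (T i \<omega>))\<bar>
        + (\<Sum>i\<in>I. 2 * e)"
  proof -
    have "\<bar>(\<Sum>i\<in>I. \<zeta> (T i \<omega>) - expectation (\<lambda>\<omega>. \<zeta> (T i \<omega>)))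
        - (\<Sum>i\<in>I. step_approx N \<zeta> (T i \<omega>) - expectation (\<lambda>\<omega>. step_approx N \<zeta> (T i \<omega>)))\<bar> \<le> (\<Sum>i\<in>I. 2 * e)"
      unfolding sum_subtractf[symmetric]
    proof (rule order_trans[OF sum_abs sum_mono])
      fix i assume "i \<in> I"
      then show "\<bar>\<zeta> (T i \<omega>) - expectation (\<lambda>\<omega>. \<zeta> (T i \<omega>))
          - (step_approx N \<zeta> (T i \<omega>) - expectation (\<lambda>\<omega>. step_approx N \<zeta> (T i \<omega>)))\<bar> \<le> 2 * e"
        using err[of i \<omega>] Eerr[of i] \<omega> by linarith
    qed
    then show ?thesis by linarith
  qed
  also have "(\<Sum>i\<in>I. step_approx N \<zeta> (T i \<omega>) - expectation (\<lambda>\<omega>. step_approx N \<zeta> (T i \<omega>)))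
      = (\<Sum>i\<in>I. \<Sum>j<N. - c j * (b j i \<omega> - expectation (b j i)))"
    by (intro sum.cong refl, simp only: Es)
       (simp add: step algebra_simps sum_subtractf sum_negf)
  also have "\<dots> = (\<Sum>j<N. - c j * (\<Sum>i\<in>I. b j i \<omega> - expectation (b j i)))"
    by (subst sum.swap) (simp add: sum_distrib_left)
  also have "\<bar>\<dots>\<bar> \<le> (\<Sum>j<N. e * \<bar>\<Sum>i\<in>I. b j i \<omega> - expectation (b j i)\<bar>)"
  proof (rule order_trans[OF sum_abs sum_mono])
    fix j
    have "\<bar>c j\<bar> \<le> L * \<bar>grid N (Suc j) - grid N j\<bar>" unfolding c_def by (rule lip)
    also have "\<bar>grid N (Suc j) - grid N j\<bar> = 2 * pi / N"
      using N by (simp add: grid_def field_simps)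
    finally have "\<bar>c j\<bar> \<le> e" by (simp add: e_def)
    then show "\<bar>- c j * (\<Sum>i\<in>I. b j i \<omega> - expectation (b j i))\<bar> \<le> e * \<bar>\<Sum>i\<in>I. b j i \<omega> - expectation (b j i)\<bar>"
      by (simp add: abs_mult mult_right_mono)
  qed
  finally show ?thesis
    unfolding e_def[symmetric] b_def by (simp add: sum_distrib_left)
qed

section \<open>Arclength densities as laws of angles\<close>

text \<open>
  Rotation invariance of arclength: the piece of the shifted period that sticks out at the right is moved back by
  \<open>2\<pi>\<close>.
\<close>

lemma nn_integral_period_shift:
  fixes h :: "real \<Rightarrow> ennreal"
  assumes [measurable]: "h \<in> borel_measurable borel"
    and per: "\<And>t. h (t + 2 * pi) = h t" and s: "0 \<le> s" "s \<le> 2 * pi"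
  shows "(\<integral>\<^sup>+t\<in>{-pi..<pi}. h (s + t) \<partial>lborel) = (\<integral>\<^sup>+t\<in>{-pi..<pi}. h t \<partial>lborel)"
proof -
  have ind: "indicator {-pi..<pi} t = indicator {-pi..<s-pi} t + (indicator {s-pi..<pi} t :: ennreal)" for t :: real
    using s by (auto simp: indicator_def)
  have "(\<integral>\<^sup>+t\<in>{-pi..<pi}. h t \<partial>lborel) = (\<integral>\<^sup>+t\<in>{-pi..<s-pi}. h t \<partial>lborel) + (\<integral>\<^sup>+t\<in>{s-pi..<pi}. h t \<partial>lborel)"
    unfolding ind distrib_left by (intro nn_integral_add) auto
  also have "(\<integral>\<^sup>+t\<in>{-pi..<s-pi}. h t \<partial>lborel) = (\<integral>\<^sup>+t\<in>{pi..<s+pi}. h t \<partial>lborel)"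
    by (subst (2) nn_integral_real_affine[of _ 1 "2 * pi"])
       (auto intro!: nn_integral_cong simp: indicator_def per add.commute[of "2 * pi"])
  also have "\<dots> + (\<integral>\<^sup>+t\<in>{s-pi..<pi}. h t \<partial>lborel)
      = (\<integral>\<^sup>+t. h t * indicator {pi..<s+pi} t + h t * indicator {s-pi..<pi} t \<partial>lborel)"
    by (intro nn_integral_add[symmetric]) auto
  also have "\<dots> = (\<integral>\<^sup>+t\<in>{s-pi..<s+pi}. h t \<partial>lborel)"
    using s by (intro nn_integral_cong) (auto simp: indicator_def)
  also have "\<dots> = (\<integral>\<^sup>+t\<in>{-pi..<pi}. h (s + t) \<partial>lborel)"
    by (subst nn_integral_real_affine[of _ 1 s])
       (auto intro!: nn_integral_cong simp: indicator_def)
  finally show ?thesis by simp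
qed

lemma circ_measurable [measurable]: "(\<lambda>t. circ (s + t)) \<in> borel \<rightarrow>\<^sub>M circle_borel"
  unfolding circle_borel_def
  by (intro measurable_restrict_space2 borel_measurable_continuous_onI)
     (auto simp: circ_def S1_def intro!: continuous_intros)

lemma space_circle_borel: "space circle_borel = S1"
  by (simp add: circle_borel_def space_restrict_space)

lemma density_arclength_unrolled:
  fixes f :: "real \<times> real \<Rightarrow> real"
  assumes f [measurable]: "f \<in> borel_measurable circle_borel"
    and s: "0 \<le> s" "s \<le> 2 * pi"
  shows "density arclength (\<lambda>y. ennreal (f y))
    = distr (density lborel (\<lambda>t. indicator {-pi..<pi} t * ennreal (f (circ (s + t))))) circle_borel (\<lambda>t. circ (s + t))"
    (is "?L = distr ?N _ _")
proof (rule measure_eqI)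
  show "sets ?L = sets (distr ?N circle_borel (\<lambda>t. circ (s + t)))"
    by (simp add: arclength_def)
  fix A assume "A \<in> sets ?L"
  then have A [measurable]: "A \<in> sets circle_borel" by (simp add: arclength_def)
  have exp0: "circle_exp (1, 0) = circ"
    using circle_exp_circ[of 0] by (auto simp: circ_def)
  have [measurable]: "circ \<in> borel \<rightarrow>\<^sub>M circle_borel" using circ_measurable[of 0] by simp
  have circ_L: "circ \<in> restrict_space lborel {-pi..<pi} \<rightarrow>\<^sub>M circle_borel"
    by (intro measurable_restrict_space1) simp
  have "emeasure ?L A = (\<integral>\<^sup>+y. ennreal (f y) * indicator A y \<partial>arclength)"
    by (intro emeasure_density) (auto simp: arclength_def)
  also have "\<dots> = (\<integral>\<^sup>+t. ennreal (f (circ t)) * indicator A (circ t) \<partial>restrict_space lborel {-pi..<pi})"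
    unfolding arclength_def exp0 by (intro nn_integral_distr circ_L) auto
  also have "\<dots> = (\<integral>\<^sup>+t\<in>{-pi..<pi}. ennreal (f (circ t)) * indicator A (circ t) \<partial>lborel)"
    by (subst nn_integral_restrict_space) auto
  also have "\<dots> = (\<integral>\<^sup>+t\<in>{-pi..<pi}. ennreal (f (circ (s + t))) * indicator A (circ (s + t)) \<partial>lborel)"
    using s circ_add_2pi_int[of _ 1] by (intro nn_integral_period_shift[symmetric]) auto
  also have "\<dots> = (\<integral>\<^sup>+t. indicator ((\<lambda>t. circ (s + t)) -` A) t \<partial>?N)"
    by (subst nn_integral_density) (auto intro!: nn_integral_cong simp: indicator_def)
  also have "\<dots> = emeasure ?N ((\<lambda>t. circ (s + t)) -` A)"
    using measurable_sets[OF circ_measurable A] by (intro nn_integral_indicator) simp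
  also have "\<dots> = emeasure (distr ?N circle_borel (\<lambda>t. circ (s + t))) A"
    by (subst emeasure_distr) auto
  finally show "emeasure ?L A = emeasure (distr ?N circle_borel (\<lambda>t. circ (s + t))) A" .
qed

text \<open>
  Angles are measured from the point at which property \<open>P\<close> holds, which becomes \<open>circ s\<close>.
\<close>

lemma angle_law_of_property_P:
  fixes f :: "real \<times> real \<Rightarrow> real"
  assumes f [measurable]: "f \<in> borel_measurable circle_borel"
    and f_nonneg: "\<And>y. y \<in> S1 \<Longrightarrow> 0 \<le> f y"
    and mu: "\<mu> = density arclength (\<lambda>y. ennreal (f y))" and prob: "prob_space \<mu>"
    and P: "in_class_P f \<alpha> \<phi>"
  obtains s \<nu> where "light_tail_angle_law \<nu> \<alpha> \<phi>" "\<mu> = distr \<nu> circle_borel (\<lambda>t. circ (s + t))"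
proof -
  obtain p where p: "p \<in> S1" and alpha: "0 < \<alpha>" "\<alpha> \<le> 1" and phi: "0 < \<phi>" "\<phi> < pi"
    and small: "\<And>\<theta>. -pi \<le> \<theta> \<Longrightarrow> \<theta> < pi \<Longrightarrow> \<phi> \<le> \<bar>\<theta>\<bar> \<Longrightarrow> f (circle_exp p \<theta>) \<le> (1 - \<alpha>) / (2 * pi)"
    using P by (auto simp: in_class_P_def property_P_def)
  obtain s where s: "0 \<le> s" "s < 2 * pi" "p = circ s"
  proof -
    have "(fst p)\<^sup>2 + (snd p)\<^sup>2 = 1" using p by (auto simp: S1_def)
    then show thesis using sincos_total_2pi that by (metis circ_def prod.collapse)
  qed
  define g where "g = (\<lambda>t. f (circ (s + t)))"
  have [measurable]: "g \<in> borel_measurable borel" unfolding g_def by measurable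
  have g0: "0 \<le> g t" for t by (simp add: g_def f_nonneg)
  define \<nu> where "\<nu> = density lborel (\<lambda>t. indicator {-pi..<pi} t * ennreal (g t))"
  have mu_nu: "\<mu> = distr \<nu> circle_borel (\<lambda>t. circ (s + t))"
    unfolding mu \<nu>_def g_def using s by (intro density_arclength_unrolled) auto
  have sets_nu [measurable_cong]: "sets \<nu> = sets borel" by (simp add: \<nu>_def)
  have circ_nu: "(\<lambda>t. circ (s + t)) \<in> \<nu> \<rightarrow>\<^sub>M circle_borel" by measurable
  have "prob_space \<nu>"
  proof
    interpret \<mu>: prob_space \<mu> by (rule prob)
    have "emeasure \<mu> (space \<mu>) = emeasure \<nu> ((\<lambda>t. circ (s + t)) -` S1 \<inter> space \<nu>)"
      unfolding mu_nu using circ_nu sets.top[of circle_borel]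
      by (simp add: emeasure_distr space_circle_borel)
    also have "(\<lambda>t. circ (s + t)) -` S1 \<inter> space \<nu> = space \<nu>" by auto
    finally have "emeasure \<mu> (space \<mu>) = emeasure \<nu> (space \<nu>)" .
    then show "emeasure \<nu> (space \<nu>) = 1" by (simp add: \<mu>.emeasure_space_1)
  qed
  then have "light_tail_angle_law \<nu> \<alpha> \<phi>"
    unfolding light_tail_angle_law_def light_tail_angle_law_axioms_def
  proof (intro conjI allI impI)
    show "sets \<nu> = sets borel" by (rule sets_nu)
    show "AE t in \<nu>. \<bar>t\<bar> \<le> pi"
      unfolding \<nu>_def by (subst AE_density) (auto simp: indicator_def)
    fix h :: "real \<Rightarrow> real"
    assume h: "continuous_on UNIV h" and h0: "\<forall>t. 0 \<le> h t" and hz: "\<forall>t. \<bar>t\<bar> < \<phi> \<longrightarrow> h t = 0"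
    have [measurable]: "h \<in> borel_measurable borel" using h by (rule borel_measurable_continuous_onI)
    have "h integrable_on {-pi..pi}"
      by (intro integrable_continuous_interval continuous_on_subset[OF h]) auto
    then have hI: "((\<lambda>t. (1 - \<alpha>) / (2 * pi) * h t) has_integral (1 - \<alpha>) / (2 * pi) * integral {-pi..pi} h) {-pi..pi}"
      by (intro has_integral_mult_right integrable_integral)
    have "(\<integral>\<^sup>+t. ennreal (h t) \<partial>\<nu>) = (\<integral>\<^sup>+t. indicator {-pi..<pi} t * ennreal (g t) * ennreal (h t) \<partial>lborel)"
      unfolding \<nu>_def by (subst nn_integral_density) auto
    also have "\<dots> \<le> (\<integral>\<^sup>+t\<in>{-pi..pi}. ennreal ((1 - \<alpha>) / (2 * pi) * h t) \<partial>lborel)"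
    proof (intro nn_integral_mono)
      fix t
      have "g t * h t \<le> (1 - \<alpha>) / (2 * pi) * h t" if "t \<in> {-pi..<pi}"
      proof (cases "\<bar>t\<bar> < \<phi>")
        case False
        then have "g t \<le> (1 - \<alpha>) / (2 * pi)"
          using small[of t] that by (simp add: g_def s circle_exp_circ)
        then show ?thesis using h0 by (intro mult_right_mono) auto
      qed (use hz in simp)
      then show "indicator {-pi..<pi} t * ennreal (g t) * ennreal (h t)
          \<le> ennreal ((1 - \<alpha>) / (2 * pi) * h t) * indicator {-pi..pi} t"
        using g0[of t] h0[rule_format, of t]
        by (auto simp: indicator_def ennreal_mult[symmetric] intro!: ennreal_leI)
    qed
    also have "\<dots> = ennreal ((1 - \<alpha>) / (2 * pi) * integral {-pi..pi} h)"
      using hI h0 alpha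
      by (intro nn_integral_has_integral_lebesgue') auto
    finally have le: "(\<integral>\<^sup>+t. ennreal (h t) \<partial>\<nu>) \<le> ennreal ((1 - \<alpha>) / (2 * pi) * integral {-pi..pi} h)" .
    have "0 \<le> integral {-pi..pi} h"
      using h0 by (intro integral_nonneg integrable_continuous_interval continuous_on_subset[OF h]) auto
    then show "integral\<^sup>L \<nu> h \<le> (1 - \<alpha>) / (2 * pi) * integral {-pi..pi} h"
      using h0 alpha le by (intro integral_real_bounded) auto
  qed (use alpha phi in auto)
  then show thesis using mu_nu by (rule that)
qed

section \<open>Minimizers of the empirical Frechet functional\<close>

definition angle_of :: "real \<times> real \<Rightarrow> real" where
  "angle_of q = (if snd q \<ge> 0 then arccos (fst q) else - arccos (fst q))"

lemma S1_fst_bounds: "q \<in> S1 \<Longrightarrow> -1 \<le> fst q \<and> fst q \<le> 1"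
proof -
  assume "q \<in> S1"
  then have "(fst q)\<^sup>2 + (snd q)\<^sup>2 = 1" by (auto simp: S1_def)
  then have "(fst q)\<^sup>2 \<le> 1" using zero_le_power2[of "snd q"] by linarith
  then show ?thesis by (simp add: abs_square_le_1 abs_le_iff)
qed

lemma circ_angle_of: "q \<in> S1 \<Longrightarrow> circ (angle_of q) = q"
proof -
  assume q: "q \<in> S1"
  have "\<bar>snd q\<bar> = sqrt (1 - (fst q)\<^sup>2)"
    using q by (auto simp: S1_def real_sqrt_abs[symmetric] algebra_simps simp del: real_sqrt_abs)
  then show ?thesis
    using S1_fst_bounds[OF q]
    by (auto simp: angle_of_def circ_def prod_eq_iff sin_arccos cos_arccos)
qed

lemma abs_angle_of_le: "q \<in> S1 \<Longrightarrow> \<bar>angle_of q\<bar> \<le> pi"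
  using S1_fst_bounds[of q] arccos_lbound[of "fst q"] arccos_ubound[of "fst q"]
  by (auto simp: angle_of_def)

lemma angle_of_measurable [measurable]: "angle_of \<in> borel_measurable circle_borel"
proof -
  have "continuous_on UNIV (\<lambda>q :: real \<times> real. arccos (max (-1) (min 1 (fst q))))"
    by (intro continuous_on_arccos continuous_intros) auto
  then have [measurable]: "(\<lambda>q :: real \<times> real. arccos (max (-1) (min 1 (fst q)))) \<in> borel_measurable borel"
    by (rule borel_measurable_continuous_onI)
  have [measurable]: "(snd :: real \<times> real \<Rightarrow> real) \<in> borel_measurable borel"
    by (intro borel_measurable_continuous_onI continuous_intros)
  have "(\<lambda>q :: real \<times> real. if snd q \<ge> 0 then arccos (max (-1) (min 1 (fst q))) else - arccos (max (-1) (min 1 (fst q))))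
      \<in> borel_measurable borel"
    by measurable
  then have "(\<lambda>q :: real \<times> real. if snd q \<ge> 0 then arccos (max (-1) (min 1 (fst q))) else - arccos (max (-1) (min 1 (fst q))))
      \<in> borel_measurable circle_borel"
    unfolding circle_borel_def by (rule measurable_restrict_space1)
  moreover have clamp: "max (-1) (min 1 (fst q)) = fst q" if "q \<in> S1" for q
    using S1_fst_bounds[OF that] by auto
  ultimately show ?thesis
    by (elim measurable_cong[THEN iffD1, rotated])
       (simp add: space_circle_borel angle_of_def clamp)
qed

text \<open>
  From here on \<open>t\<close> lists the angles of a sample of size \<open>n\<close>, and \<open>sample_cost\<close> is its Frechet functional.
\<close>

definition sample_cost :: "nat \<Rightarrow> (nat \<Rightarrow> real) \<Rightarrow> real \<Rightarrow> real" where
  "sample_cost n t \<theta> = 1 / (2 * real n) * (\<Sum>i=1..n. (angle_dist (\<theta> - t i))\<^sup>2)"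

text \<open>
  The mean of the sample angles after moving each of them by full turns; as a point of the circle it depends
  only on the total number \<open>j\<close> of turns modulo \<open>n\<close>.
\<close>

definition critical_angle :: "nat \<Rightarrow> (nat \<Rightarrow> real) \<Rightarrow> int \<Rightarrow> real" where
  "critical_angle n t j = ((\<Sum>i=1..n. t i) + 2 * pi * of_int j) / real n"

text \<open>
  Lifting every sample angle to the representative closest to \<open>\<theta>\<close> turns the cost at \<open>\<theta>\<close> into a
  sum of squares on the line, which is least at the mean \<open>\<theta>'\<close> of the lifted angles; at \<open>\<theta>'\<close> this sum
  still dominates the cost. Consequently a minimizer is one of the \<open>n\<close> critical points.
\<close>

lemma sample_cost_lift:
  fixes k :: "nat \<Rightarrow> int"
  assumes n: "n \<ge> 1" and k: "\<And>i. i \<in> {1..n} \<Longrightarrow> angle_dist (\<theta> - t i) = \<bar>\<theta> - t i + 2 * pi * of_int (k i)\<bar>"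
  defines "\<theta>' \<equiv> critical_angle n t (- (\<Sum>i=1..n. k i))"
  shows "sample_cost n t \<theta>' + (\<theta> - \<theta>')\<^sup>2 / 2 \<le> sample_cost n t \<theta>"
proof -
  let ?d = "\<lambda>\<theta> i. \<theta> - t i + 2 * pi * of_int (k i)"
  have "(\<Sum>i=1..n. ?d \<theta>' i) = real n * \<theta>' - (\<Sum>i=1..n. t i) + 2 * pi * of_int (\<Sum>i=1..n. k i)"
    by (simp add: sum.distrib sum_subtractf sum_distrib_left)
  also have "\<dots> = 0"
    using n by (simp add: \<theta>'_def critical_angle_def field_simps)
  finally have zero: "(\<Sum>i=1..n. ?d \<theta>' i) = 0" .
  have "(\<Sum>i=1..n. (angle_dist (\<theta> - t i))\<^sup>2) = (\<Sum>i=1..n. (?d \<theta> i)\<^sup>2)"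
    using k by (intro sum.cong) auto
  also have "\<dots> = (\<Sum>i=1..n. (?d \<theta>' i)\<^sup>2 + 2 * (\<theta> - \<theta>') * ?d \<theta>' i + (\<theta> - \<theta>')\<^sup>2)"
    by (intro sum.cong refl) (simp add: power2_eq_square algebra_simps)
  also have "\<dots> = (\<Sum>i=1..n. (?d \<theta>' i)\<^sup>2) + real n * (\<theta> - \<theta>')\<^sup>2"
    using zero by (simp add: sum.distrib flip: sum_distrib_left)
  finally have eq: "(\<Sum>i=1..n. (angle_dist (\<theta> - t i))\<^sup>2) = (\<Sum>i=1..n. (?d \<theta>' i)\<^sup>2) + real n * (\<theta> - \<theta>')\<^sup>2" .
  have "(\<Sum>i=1..n. (angle_dist (\<theta>' - t i))\<^sup>2) \<le> (\<Sum>i=1..n. (?d \<theta>' i)\<^sup>2)"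
  proof (rule sum_mono)
    fix i
    have "angle_dist (\<theta>' - t i) \<le> \<bar>?d \<theta>' i\<bar>"
      using angle_dist_le_abs[of "?d \<theta>' i"] by (simp add: angle_dist_add_2pi_int)
    then show "(angle_dist (\<theta>' - t i))\<^sup>2 \<le> (?d \<theta>' i)\<^sup>2"
      using power_mono[OF _ angle_dist_nonneg, of "\<theta>' - t i" "\<bar>?d \<theta>' i\<bar>" 2] by simp
  qed
  then have "(\<Sum>i=1..n. (angle_dist (\<theta>' - t i))\<^sup>2) + real n * (\<theta> - \<theta>')\<^sup>2 \<le> (\<Sum>i=1..n. (angle_dist (\<theta> - t i))\<^sup>2)"
    using eq by linarith
  then have "1 / (2 * real n) * ((\<Sum>i=1..n. (angle_dist (\<theta>' - t i))\<^sup>2) + real n * (\<theta> - \<theta>')\<^sup>2)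
      \<le> 1 / (2 * real n) * (\<Sum>i=1..n. (angle_dist (\<theta> - t i))\<^sup>2)"
    by (intro mult_left_mono) auto
  then show ?thesis using n by (simp add: sample_cost_def distrib_left)
qed

lemma circ_critical_angle_mod:
  assumes n: "n \<ge> 1"
  obtains j where "j < n" "circ (critical_angle n t k) = circ (critical_angle n t (int j))"
    "sample_cost n t' (critical_angle n t k) = sample_cost n t' (critical_angle n t (int j))"
proof -
  define j where "j = nat (k mod int n)"
  have j: "int j = k mod int n" "j < n" using n by (auto simp: j_def nat_less_iff)
  have "k = int j + int n * (k div int n)" using j by simp
  then have "real_of_int k = real_of_int (int j + int n * (k div int n))" by simp
  then have eq: "critical_angle n t k = critical_angle n t (int j) + 2 * pi * of_int (k div int n)"
    using n by (simp add: critical_angle_def field_simps)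
  have "angle_dist (critical_angle n t k - t' i) = angle_dist (critical_angle n t (int j) - t' i)" for i
    using angle_dist_add_2pi_int[of "critical_angle n t (int j) - t' i" "k div int n"]
    unfolding eq by (simp add: algebra_simps)
  then show thesis
    using j by (intro that[of j]) (auto simp: eq circ_add_2pi_int sample_cost_def)
qed

lemma exists_wrapping:
  obtains k :: "nat \<Rightarrow> int" where "k \<in> {1..n} \<rightarrow>\<^sub>E UNIV"
    "\<And>i. i \<in> {1..n} \<Longrightarrow> angle_dist (\<theta> - t i) = \<bar>\<theta> - t i + 2 * pi * of_int (k i)\<bar>"
proof -
  have "\<exists>k :: int. angle_dist (\<theta> - t i) = \<bar>\<theta> - t i + 2 * pi * of_int k\<bar>" for i
    by (rule angle_dist_attained[of "\<theta> - t i"]) blast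
  then obtain k :: "nat \<Rightarrow> int" where "\<And>i. angle_dist (\<theta> - t i) = \<bar>\<theta> - t i + 2 * pi * of_int (k i)\<bar>"
    by metis
  then show thesis by (intro that[of "restrict k {1..n}"]) auto
qed

lemma critical_angle_le:
  assumes n: "n \<ge> 1"
  obtains j where "j < n" "sample_cost n t (critical_angle n t (int j)) \<le> sample_cost n t \<theta>"
proof -
  obtain k :: "nat \<Rightarrow> int" where k: "\<And>i. i \<in> {1..n} \<Longrightarrow> angle_dist (\<theta> - t i) = \<bar>\<theta> - t i + 2 * pi * of_int (k i)\<bar>"
    by (rule exists_wrapping[of n \<theta> t]) blast
  have "sample_cost n t (critical_angle n t (- (\<Sum>i=1..n. k i))) \<le> sample_cost n t \<theta>"
    using sample_cost_lift[where n = n and t = t and \<theta> = \<theta> and k = k, OF n k] by (smt (verit) zero_le_power2 divide_nonneg_pos)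
  then show thesis using circ_critical_angle_mod[OF n] that by metis
qed

lemma minimizer_is_critical:
  fixes k :: "nat \<Rightarrow> int"
  assumes n: "n \<ge> 1" and min: "\<And>\<theta>'. sample_cost n t \<theta> \<le> sample_cost n t \<theta>'"
    and k: "\<And>i. i \<in> {1..n} \<Longrightarrow> angle_dist (\<theta> - t i) = \<bar>\<theta> - t i + 2 * pi * of_int (k i)\<bar>"
  shows "\<theta> = critical_angle n t (- (\<Sum>i=1..n. k i))"
proof -
  define \<theta>' where "\<theta>' = critical_angle n t (- (\<Sum>i=1..n. k i))"
  have "(\<theta> - \<theta>')\<^sup>2 \<le> 0"
    using sample_cost_lift[where n = n and t = t and \<theta> = \<theta> and k = k, OF n k] min[of \<theta>'] unfolding \<theta>'_def[symmetric] by linarith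
  then show ?thesis by (simp add: \<theta>'_def)
qed

text \<open>
  The centred turn numbers of a lift. They sum to zero, and the cost of a minimizer depends on its
  lift only through them, in an affine way up to a term common to all lifts.
\<close>

definition tie_weight :: "nat \<Rightarrow> (nat \<Rightarrow> int) \<Rightarrow> nat \<Rightarrow> real" where
  "tie_weight n k i = of_int (k i) - of_int (\<Sum>i=1..n. k i) / real n"

lemma sample_cost_minimizer:
  fixes k :: "nat \<Rightarrow> int"
  assumes n: "n \<ge> 1" and min: "\<And>\<theta>'. sample_cost n t \<theta> \<le> sample_cost n t \<theta>'"
    and k: "\<And>i. i \<in> {1..n} \<Longrightarrow> angle_dist (\<theta> - t i) = \<bar>\<theta> - t i + 2 * pi * of_int (k i)\<bar>"
  shows "2 * real n * sample_cost n t \<theta> = (\<Sum>i=1..n. ((\<Sum>i=1..n. t i) / n - t i)\<^sup>2)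
    - 4 * pi * (\<Sum>i=1..n. tie_weight n k i * t i) + 4 * pi\<^sup>2 * (\<Sum>i=1..n. (tie_weight n k i)\<^sup>2)"
proof -
  define m where "m = (\<Sum>i=1..n. t i) / real n"
  have sum0: "(\<Sum>i=1..n. tie_weight n k i) = 0"
    using n by (simp add: tie_weight_def sum_subtractf)
  have \<theta>: "\<theta> = m - 2 * pi * of_int (\<Sum>i=1..n. k i) / real n"
    using minimizer_is_critical[where n = n and t = t and \<theta> = \<theta> and k = k, OF n min k]
    by (simp add: critical_angle_def m_def diff_divide_distrib)
  have "2 * real n * sample_cost n t \<theta> = (\<Sum>i=1..n. (angle_dist (\<theta> - t i))\<^sup>2)"
    using n by (simp add: sample_cost_def)
  also have "\<dots> = (\<Sum>i=1..n. (m - t i + 2 * pi * tie_weight n k i)\<^sup>2)"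
  proof (intro sum.cong refl)
    fix i assume "i \<in> {1..n}"
    then show "(angle_dist (\<theta> - t i))\<^sup>2 = (m - t i + 2 * pi * tie_weight n k i)\<^sup>2"
      by (simp add: k) (simp add: \<theta> tie_weight_def algebra_simps)
  qed
  also have "\<dots> = (\<Sum>i=1..n. (m - t i)\<^sup>2 + 4 * pi * m * tie_weight n k i
      - 4 * pi * (tie_weight n k i * t i) + 4 * pi\<^sup>2 * (tie_weight n k i)\<^sup>2)"
    by (intro sum.cong refl) (simp add: power2_eq_square algebra_simps)
  also have "\<dots> = (\<Sum>i=1..n. (m - t i)\<^sup>2) + 4 * pi * m * (\<Sum>i=1..n. tie_weight n k i)
      - 4 * pi * (\<Sum>i=1..n. tie_weight n k i * t i) + 4 * pi\<^sup>2 * (\<Sum>i=1..n. (tie_weight n k i)\<^sup>2)"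
    by (simp add: sum.distrib sum_subtractf sum_distrib_left)
  finally show ?thesis unfolding sum0 by (simp add: m_def)
qed

text \<open>
  Two distinct minimizers can coexist only if the sample satisfies one of countably many affine relations. The
  relation is nontrivial: equal weights would mean that the two lifts differ by the same number
  of turns everywhere, and then both minimizers are the same point.
\<close>

lemma tie_imp_affine_relation:
  assumes n: "n \<ge> 1" and min: "\<And>\<theta>''. sample_cost n t \<theta> \<le> sample_cost n t \<theta>''"
    and min': "\<And>\<theta>''. sample_cost n t \<theta>' \<le> sample_cost n t \<theta>''" and neq: "circ \<theta> \<noteq> circ \<theta>'"
  obtains k k' :: "nat \<Rightarrow> int" and i where "k \<in> {1..n} \<rightarrow>\<^sub>E UNIV" "k' \<in> {1..n} \<rightarrow>\<^sub>E UNIV"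
    "i \<in> {1..n}" "tie_weight n k i - tie_weight n k' i \<noteq> 0"
    "(\<Sum>i=1..n. (tie_weight n k i - tie_weight n k' i) * t i)
      = pi * ((\<Sum>i=1..n. (tie_weight n k i)\<^sup>2) - (\<Sum>i=1..n. (tie_weight n k' i)\<^sup>2))"
proof -
  obtain k :: "nat \<Rightarrow> int" where kE: "k \<in> {1..n} \<rightarrow>\<^sub>E UNIV"
    and k: "\<And>i. i \<in> {1..n} \<Longrightarrow> angle_dist (\<theta> - t i) = \<bar>\<theta> - t i + 2 * pi * of_int (k i)\<bar>"
    by (rule exists_wrapping[of n \<theta> t]) blast
  obtain k' :: "nat \<Rightarrow> int" where kE': "k' \<in> {1..n} \<rightarrow>\<^sub>E UNIV"
    and k': "\<And>i. i \<in> {1..n} \<Longrightarrow> angle_dist (\<theta>' - t i) = \<bar>\<theta>' - t i + 2 * pi * of_int (k' i)\<bar>"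
    by (rule exists_wrapping[of n \<theta>' t]) blast
  have "\<exists>i\<in>{1..n}. tie_weight n k i - tie_weight n k' i \<noteq> 0"
  proof (rule ccontr)
    assume "\<not> ?thesis"
    then have "tie_weight n k 1 = tie_weight n k' 1" using n by auto
    then have "real_of_int (\<Sum>i=1..n. k i) / n - of_int (\<Sum>i=1..n. k' i) / n = of_int (k 1 - k' 1)"
      by (simp add: tie_weight_def)
    then have "critical_angle n t (- (\<Sum>i=1..n. k' i)) = critical_angle n t (- (\<Sum>i=1..n. k i)) + 2 * pi * of_int (k 1 - k' 1)"
      unfolding critical_angle_def by (elim subst) (use n in \<open>simp add: field_simps\<close>)
    then have "\<theta>' = \<theta> + 2 * pi * of_int (k 1 - k' 1)"
      using minimizer_is_critical[where n = n and t = t and \<theta> = \<theta> and k = k, OF n min k]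
        minimizer_is_critical[where n = n and t = t and \<theta> = \<theta>' and k = k', OF n min' k'] by simp
    with neq show False using circ_add_2pi_int[of \<theta> "k 1 - k' 1"] by simp
  qed
  then obtain i where i: "i \<in> {1..n}" "tie_weight n k i - tie_weight n k' i \<noteq> 0" by auto
  have "sample_cost n t \<theta> = sample_cost n t \<theta>'" using min[of \<theta>'] min'[of \<theta>] by simp
  then have "4 * pi * ((\<Sum>i=1..n. tie_weight n k i * t i) - (\<Sum>i=1..n. tie_weight n k' i * t i))
      = 4 * pi * (pi * ((\<Sum>i=1..n. (tie_weight n k i)\<^sup>2) - (\<Sum>i=1..n. (tie_weight n k' i)\<^sup>2)))"
    using sample_cost_minimizer[where n = n and t = t and \<theta> = \<theta> and k = k, OF n min k] sample_cost_minimizer[where n = n and t = t and \<theta> = \<theta>' and k = k', OF n min' k']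
    by (simp add: right_diff_distrib power2_eq_square)
  then have "(\<Sum>i=1..n. (tie_weight n k i - tie_weight n k' i) * t i)
      = pi * ((\<Sum>i=1..n. (tie_weight n k i)\<^sup>2) - (\<Sum>i=1..n. (tie_weight n k' i)\<^sup>2))"
    by (simp add: left_diff_distrib sum_subtractf)
  with kE kE' i show thesis by (rule that)
qed

text \<open>
  Given the remaining variables, the relation prescribes the value of \<open>T j\<close>; by independence, and
  because \<open>T j\<close> has no atoms, this has probability zero.
\<close>

lemma (in prob_space) AE_affine_relation_fails:
  fixes T :: "'i \<Rightarrow> 'a \<Rightarrow> real"
  assumes I: "finite I" and indep: "indep_vars (\<lambda>_. borel) T I"
    and atomless: "\<And>i c. i \<in> I \<Longrightarrow> AE \<omega> in M. T i \<omega> \<noteq> c"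
    and j: "j \<in> I" "a j \<noteq> 0"
  shows "AE \<omega> in M. (\<Sum>i\<in>I. a i * T i \<omega>) \<noteq> b"
proof -
  have rv [measurable]: "random_variable borel (T i)" if "i \<in> I" for i
    using indep that by (simp add: indep_vars_def)
  define Y where "Y = (\<lambda>\<omega>. a j * T j \<omega>)"
  define Z where "Z = (\<lambda>\<omega>. \<Sum>i\<in>I - {j}. a i * T i \<omega>)"
  have [measurable]: "random_variable borel Y" "random_variable borel Z"
    unfolding Y_def Z_def using j by measurable
  have "indep_vars (\<lambda>_. borel) (\<lambda>i \<omega>. a i * T i \<omega>) (insert j (I - {j}))"
    unfolding insert_Diff[OF j(1)] by (rule indep_vars_compose2[OF indep]) auto
  then have "indep_var borel Y borel Z"
    unfolding Y_def Z_def using I by (intro indep_vars_sum) auto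
  then have distr: "distr M borel Y \<Otimes>\<^sub>M distr M borel Z = distr M (borel \<Otimes>\<^sub>M borel) (\<lambda>\<omega>. (Y \<omega>, Z \<omega>))"
    by (simp add: indep_var_distribution_eq)
  interpret Y: prob_space "distr M borel Y" by (rule prob_space_distr) simp
  interpret Z: prob_space "distr M borel Z" by (rule prob_space_distr) simp
  interpret YZ: pair_prob_space "distr M borel Y" "distr M borel Z" ..
  have "AE z in distr M borel Z. AE y in distr M borel Y. y + z \<noteq> b"
  proof (rule AE_I2)
    fix z
    have "AE \<omega> in M. Y \<omega> + z \<noteq> b"
      using atomless[OF j(1), of "(b - z) / a j"] by eventually_elim (use j in \<open>auto simp: Y_def field_simps\<close>)
    then show "AE y in distr M borel Y. y + z \<noteq> b"
      by (subst AE_distr_iff) auto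
  qed
  then have "AE y in distr M borel Y. AE z in distr M borel Z. y + z \<noteq> b"
  proof (subst YZ.AE_commute)
    show "{p \<in> space (distr M borel Y \<Otimes>\<^sub>M distr M borel Z). fst p + snd p \<noteq> b}
        \<in> sets (distr M borel Y \<Otimes>\<^sub>M distr M borel Z)"
      by measurable
  qed
  then have "AE p in distr M borel Y \<Otimes>\<^sub>M distr M borel Z. fst p + snd p \<noteq> b"
  proof (intro YZ.AE_pair_measure)
    show "{p \<in> space (distr M borel Y \<Otimes>\<^sub>M distr M borel Z). fst p + snd p \<noteq> b}
        \<in> sets (distr M borel Y \<Otimes>\<^sub>M distr M borel Z)"
      by measurable
  qed auto
  then have "AE \<omega> in M. Y \<omega> + Z \<omega> \<noteq> b"
    unfolding distr by (subst (asm) AE_distr_iff) auto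
  moreover have "(\<Sum>i\<in>I. a i * T i \<omega>) = Y \<omega> + Z \<omega>" for \<omega>
    using I j by (simp add: Y_def Z_def sum.remove)
  ultimately show ?thesis by simp
qed

lemma (in prob_space) AE_no_tie:
  fixes T :: "nat \<Rightarrow> 'a \<Rightarrow> real"
  assumes n: "n \<ge> 1" and indep: "indep_vars (\<lambda>_. borel) T {1..n}"
    and atomless: "\<And>i c. i \<in> {1..n} \<Longrightarrow> AE \<omega> in M. T i \<omega> \<noteq> c"
  shows "AE \<omega> in M. \<forall>\<theta> \<theta>'. (\<forall>\<theta>''. sample_cost n (\<lambda>i. T i \<omega>) \<theta> \<le> sample_cost n (\<lambda>i. T i \<omega>) \<theta>'')
     \<longrightarrow> (\<forall>\<theta>''. sample_cost n (\<lambda>i. T i \<omega>) \<theta>' \<le> sample_cost n (\<lambda>i. T i \<omega>) \<theta>'') \<longrightarrow> circ \<theta> = circ \<theta>'"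
proof -
  let ?K = "{1..n} \<rightarrow>\<^sub>E (UNIV :: int set)"
  have K: "countable ?K" by (intro countable_PiE) auto
  have "AE \<omega> in M. \<forall>k\<in>?K. \<forall>k'\<in>?K. \<forall>i\<in>{1..n}. tie_weight n k i - tie_weight n k' i \<noteq> 0 \<longrightarrow>
     (\<Sum>i=1..n. (tie_weight n k i - tie_weight n k' i) * T i \<omega>)
      \<noteq> pi * ((\<Sum>i=1..n. (tie_weight n k i)\<^sup>2) - (\<Sum>i=1..n. (tie_weight n k' i)\<^sup>2))"
    unfolding AE_ball_countable[OF K] AE_finite_all[OF finite_atLeastAtMost]
  proof (intro ballI)
    fix k k' i assume i: "i \<in> {1..n}"
    show "AE \<omega> in M. tie_weight n k i - tie_weight n k' i \<noteq> 0 \<longrightarrow>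
     (\<Sum>i=1..n. (tie_weight n k i - tie_weight n k' i) * T i \<omega>)
      \<noteq> pi * ((\<Sum>i=1..n. (tie_weight n k i)\<^sup>2) - (\<Sum>i=1..n. (tie_weight n k' i)\<^sup>2))"
    proof (cases "tie_weight n k i - tie_weight n k' i = 0")
      case False
      have "AE \<omega> in M. (\<Sum>i=1..n. (tie_weight n k i - tie_weight n k' i) * T i \<omega>)
        \<noteq> pi * ((\<Sum>i=1..n. (tie_weight n k i)\<^sup>2) - (\<Sum>i=1..n. (tie_weight n k' i)\<^sup>2))"
        by (rule AE_affine_relation_fails[where j = i]) (use indep atomless i False in auto)
      then show ?thesis by eventually_elim simp
    qed simp
  qed
  then show ?thesis
  proof eventually_elim
    case (elim \<omega>)
    show ?case
    proof (intro allI impI, rule ccontr)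
      fix \<theta> \<theta>'
      assume min: "\<forall>\<theta>''. sample_cost n (\<lambda>i. T i \<omega>) \<theta> \<le> sample_cost n (\<lambda>i. T i \<omega>) \<theta>''"
        and min': "\<forall>\<theta>''. sample_cost n (\<lambda>i. T i \<omega>) \<theta>' \<le> sample_cost n (\<lambda>i. T i \<omega>) \<theta>''"
        and neq: "circ \<theta> \<noteq> circ \<theta>'"
      obtain k k' i where "k \<in> ?K" "k' \<in> ?K" "i \<in> {1..n}" "tie_weight n k i - tie_weight n k' i \<noteq> 0"
        "(\<Sum>i=1..n. (tie_weight n k i - tie_weight n k' i) * T i \<omega>)
          = pi * ((\<Sum>i=1..n. (tie_weight n k i)\<^sup>2) - (\<Sum>i=1..n. (tie_weight n k' i)\<^sup>2))"
        by (rule tie_imp_affine_relation[OF n min[rule_format] min'[rule_format] neq])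
      then show False using elim by blast
    qed
  qed
qed

section \<open>Frechet means of the law and of the sample\<close>

lemma frechet_mean_eqI:
  assumes "is_frechet_mean \<mu> p"
  shows "frechet_mean \<mu> = p"
  unfolding frechet_mean_def
proof (rule the_equality)
  show "is_frechet_mean \<mu> p" by (rule assms)
  show "q = p" if "is_frechet_mean \<mu> q" for q
    using assms that unfolding is_frechet_mean_def by blast
qed

lemma frechet_functional_circ_distr:
  assumes T: "T \<in> borel_measurable N"
  shows "frechet_functional (distr N circle_borel (\<lambda>\<omega>. circ (T \<omega>))) (circ \<theta>)
    = 1 / 2 * (\<integral>\<omega>. (angle_dist (T \<omega> - \<theta>))\<^sup>2 \<partial>N)"
proof -
  have [measurable]: "circ \<in> borel \<rightarrow>\<^sub>M circle_borel" using circ_measurable[of 0] by simp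
  have "(\<lambda>q. (angle_dist (angle_of q - \<theta>))\<^sup>2) \<in> borel_measurable circle_borel" by measurable
  then have "(\<lambda>q. (circle_dist q (circ \<theta>))\<^sup>2) \<in> borel_measurable circle_borel"
    by (rule measurable_cong[THEN iffD1, rotated])
       (metis circle_dist_circ circ_angle_of space_circle_borel)
  then have "(\<integral>y. (circle_dist y (circ \<theta>))\<^sup>2 \<partial>distr N circle_borel (\<lambda>\<omega>. circ (T \<omega>)))
      = (\<integral>\<omega>. (circle_dist (circ (T \<omega>)) (circ \<theta>))\<^sup>2 \<partial>N)"
    using T by (intro integral_distr) auto
  then show ?thesis by (simp add: frechet_functional_def circle_dist_circ)
qed

lemma frechet_mean_growth:
  assumes delta: "0 < \<delta>" "\<delta> < 1 / 2"
    and f: "f \<in> borel_measurable circle_borel" "\<And>y. y \<in> S1 \<Longrightarrow> 0 \<le> f y"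
    and mu: "\<mu> = density arclength (\<lambda>y. ennreal (f y))" "prob_space \<mu>"
    and P: "in_class_P f \<alpha> \<phi>"
    and alpha: "alpha_min \<delta> \<le> \<alpha>" "\<alpha> \<le> 1"
    and phi: "\<phi> \<le> \<delta> * phi_max \<alpha>"
  shows "\<exists>m. frechet_mean \<mu> = circ m \<and> 0 < gamma_const \<alpha> \<phi> \<and>
    (\<forall>\<theta>. gamma_const \<alpha> \<phi> / (8 * pi\<^sup>2) * (angle_dist (\<theta> - m))\<^sup>2
       \<le> frechet_functional \<mu> (circ \<theta>) - frechet_functional \<mu> (circ m))"
proof -
  obtain s \<nu> where nu: "light_tail_angle_law \<nu> \<alpha> \<phi>" and mu_nu: "\<mu> = distr \<nu> circle_borel (\<lambda>t. circ (s + t))"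
    by (rule angle_law_of_property_P[OF f mu P])
  note far_gap = far_gap_of_alpha_min[OF delta light_tail_angle_law.alpha(1)[OF nu] alpha
      light_tail_angle_law.phi(1)[OF nu] phi]
  interpret light_tail_angle_law \<nu> \<alpha> \<phi> by (rule nu)
  have F: "frechet_functional \<mu> (circ (s + \<theta>)) = cost \<theta>" for \<theta>
    unfolding mu_nu by (subst frechet_functional_circ_distr) (auto simp: cost_def)
  have gap: "(pi - \<phi>) * (\<phi> + tail_bound) \<le> 7 / 8 * gamma_const \<alpha> \<phi>" and gamma: "0 < gamma_const \<alpha> \<phi>"
    unfolding tail_bound_def by (rule far_gap)+
  obtain \<tau> where \<tau>: "\<And>\<theta>. gamma_const \<alpha> \<phi> / (8 * pi\<^sup>2) * (angle_dist (\<theta> - \<tau>))\<^sup>2 \<le> cost \<theta> - cost \<tau>"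
    using unique_min_growth[OF gap gamma] by blast
  define m where "m = s + \<tau>"
  have growth: "gamma_const \<alpha> \<phi> / (8 * pi\<^sup>2) * (angle_dist (\<theta> - m))\<^sup>2
       \<le> frechet_functional \<mu> (circ \<theta>) - frechet_functional \<mu> (circ m)" for \<theta>
    using \<tau>[of "\<theta> - s"] F[of "\<theta> - s"] F[of \<tau>] by (simp add: m_def diff_diff_eq)
  have min: "frechet_functional \<mu> (circ m) \<le> frechet_functional \<mu> (circ \<theta>)" for \<theta>
  proof -
    have "0 \<le> gamma_const \<alpha> \<phi> / (8 * pi\<^sup>2) * (angle_dist (\<theta> - m))\<^sup>2" using gamma by simp
    then show ?thesis using growth[of \<theta>] by linarith
  qed
  have unique: "circ \<theta> = circ m" if "frechet_functional \<mu> (circ \<theta>) \<le> frechet_functional \<mu> (circ m)" for \<theta>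
  proof -
    have "gamma_const \<alpha> \<phi> / (8 * pi\<^sup>2) * (angle_dist (\<theta> - m))\<^sup>2 \<le> 0"
      using growth[of \<theta>] that by linarith
    then have "angle_dist (\<theta> - m) = 0" using gamma by (simp add: mult_le_0_iff divide_le_0_iff zero_le_mult_iff not_le)
    then obtain k where "\<theta> - m + 2 * pi * real_of_int k = 0"
      using angle_dist_attained[of "\<theta> - m"] by (metis abs_eq_0)
    then have "m = \<theta> + 2 * pi * real_of_int k" by simp
    then show ?thesis by (simp add: circ_add_2pi_int)
  qed
  have "is_frechet_mean \<mu> (circ m)"
    unfolding is_frechet_mean_def is_arg_min_linorder
  proof (intro conjI allI impI)
    show "frechet_functional \<mu> (circ m) \<le> frechet_functional \<mu> q" if "q \<in> S1" for q
      using min[of "angle_of q"] that by (simp add: circ_angle_of)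
    fix q assume q: "q \<in> S1 \<and> (\<forall>y. y \<in> S1 \<longrightarrow> frechet_functional \<mu> q \<le> frechet_functional \<mu> y)"
    then have "frechet_functional \<mu> (circ (angle_of q)) \<le> frechet_functional \<mu> (circ m)"
      by (metis circ_angle_of circ_in_S1)
    then show "q = circ m" using unique q by (metis circ_angle_of)
  qed simp
  then have "frechet_mean \<mu> = circ m"
    by (rule frechet_mean_eqI)
  then show ?thesis using gamma growth by blast
qed

text \<open>
  Since all minimizers are critical points, the empirical Frechet mean exists exactly when some critical
  point beats the others. This is a finite comparison of measurable functions of the sample, which is how the
  event of the theorem is seen to be measurable. Different indices may describe
  the same point, so points rather than indices are compared.
\<close>

definition strict_best :: "nat \<Rightarrow> (nat \<Rightarrow> real) \<Rightarrow> nat \<Rightarrow> bool" where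
  "strict_best n t j \<longleftrightarrow> j < n \<and> (\<forall>l<n. circ (critical_angle n t (int l)) \<noteq> circ (critical_angle n t (int j)) \<longrightarrow>
     sample_cost n t (critical_angle n t (int j)) < sample_cost n t (critical_angle n t (int l)))"

lemma sample_cost_cong_circ:
  assumes "circ \<theta> = circ \<theta>'"
  shows "sample_cost n t \<theta> = sample_cost n t \<theta>'"
  unfolding sample_cost_def using circle_dist_circ[of \<theta>] circle_dist_circ[of \<theta>'] assms by simp

lemma strict_best_minimizes:
  assumes n: "n \<ge> 1" and j: "strict_best n t j"
  shows "sample_cost n t (critical_angle n t (int j)) \<le> sample_cost n t \<theta>"
proof -
  obtain l where l: "l < n" "sample_cost n t (critical_angle n t (int l)) \<le> sample_cost n t \<theta>"
    using critical_angle_le[OF n] by metis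
  show ?thesis
  proof (cases "circ (critical_angle n t (int l)) = circ (critical_angle n t (int j))")
    case True
    then show ?thesis using l sample_cost_cong_circ by metis
  next
    case False
    then show ?thesis using j l unfolding strict_best_def by fastforce
  qed
qed

lemma frechet_functional_sample:
  assumes "\<And>i. i \<in> {1..n} \<Longrightarrow> x i \<in> S1"
  shows "frechet_functional (empirical_measure n x) (circ \<theta>) = sample_cost n (\<lambda>i. angle_of (x i)) \<theta>"
proof -
  have "circle_dist (circ \<theta>) (x i) = angle_dist (\<theta> - angle_of (x i))" if "i \<in> {1..n}" for i
    using circle_dist_circ[of \<theta> "angle_of (x i)"] assms[OF that] by (simp add: circ_angle_of)
  then show ?thesis
    using frechet_functional_empirical_measure[where p = "circ \<theta>", OF assms] by (simp add: sample_cost_def)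
qed

text \<open>
  Without a unique minimizer \<open>frechet_mean\<close> takes a default value that is the same for all samples; this
  keeps it measurable, and the third part reduces that case to a tie.
\<close>

lemma frechet_mean_sample:
  assumes n: "n \<ge> 1" and x: "\<And>i. i \<in> {1..n} \<Longrightarrow> x i \<in> S1"
  defines "t \<equiv> \<lambda>i. angle_of (x i)"
  shows "strict_best n t j \<Longrightarrow> frechet_mean (empirical_measure n x) = circ (critical_angle n t (int j))"
    and "(\<And>j. \<not> strict_best n t j) \<Longrightarrow> frechet_mean (empirical_measure n x) = (THE p. False)"
    and "(\<And>j. \<not> strict_best n t j) \<Longrightarrow> \<exists>\<theta> \<theta>'. (\<forall>\<theta>''. sample_cost n t \<theta> \<le> sample_cost n t \<theta>'') \<and>
       (\<forall>\<theta>''. sample_cost n t \<theta>' \<le> sample_cost n t \<theta>'') \<and> circ \<theta> \<noteq> circ \<theta>'"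
proof -
  let ?F = "frechet_functional (empirical_measure n x)" and ?c = "\<lambda>j::nat. critical_angle n t (int j)"
  have F: "?F (circ \<theta>) = sample_cost n t \<theta>" for \<theta>
    unfolding t_def using x by (rule frechet_functional_sample)
  have arg_min: "is_arg_min ?F (\<lambda>q. q \<in> S1) (circ \<theta>) \<longleftrightarrow> (\<forall>\<theta>'. sample_cost n t \<theta> \<le> sample_cost n t \<theta>')" for \<theta>
    unfolding is_arg_min_linorder using F by (metis circ_angle_of circ_in_S1)
  have minimizer: "\<exists>j<n. circ \<theta> = circ (?c j)" if "\<And>\<theta>'. sample_cost n t \<theta> \<le> sample_cost n t \<theta>'" for \<theta>
  proof -
    obtain k :: "nat \<Rightarrow> int" where k: "\<And>i. i \<in> {1..n} \<Longrightarrow> angle_dist (\<theta> - t i) = \<bar>\<theta> - t i + 2 * pi * of_int (k i)\<bar>"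
      by (rule exists_wrapping[of n \<theta> t]) blast
    have "\<theta> = critical_angle n t (- (\<Sum>i=1..n. k i))"
      using n that k by (rule minimizer_is_critical)
    then show ?thesis using circ_critical_angle_mod[OF n] by metis
  qed
  show best: "frechet_mean (empirical_measure n x) = circ (?c j)" if j: "strict_best n t j" for j
  proof -
    note min = strict_best_minimizes[OF n j]
    have "is_frechet_mean (empirical_measure n x) (circ (?c j))"
      unfolding is_frechet_mean_def
    proof (intro conjI allI impI)
      show "is_arg_min ?F (\<lambda>q. q \<in> S1) (circ (?c j))" using arg_min min by blast
      fix q assume q: "is_arg_min ?F (\<lambda>q. q \<in> S1) q"
      then have "q \<in> S1" by (simp add: is_arg_min_def)
      then have q': "q = circ (angle_of q)" by (simp add: circ_angle_of)
      have qmin: "\<And>\<theta>'. sample_cost n t (angle_of q) \<le> sample_cost n t \<theta>'"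
        using q q' arg_min by metis
      then obtain l where l: "l < n" "circ (angle_of q) = circ (?c l)" using minimizer by blast
      have "sample_cost n t (?c l) \<le> sample_cost n t (?c j)" using qmin F l by metis
      then show "q = circ (?c j)" using j l q' unfolding strict_best_def by (metis not_le)
    qed
    then show ?thesis
      by (rule frechet_mean_eqI)
  qed
  assume none: "\<And>j. \<not> strict_best n t j"
  have "finite {..<n}" "{..<n} \<noteq> {}" using n by (auto simp: lessThan_empty_iff)
  then have "\<exists>j. is_arg_min (\<lambda>j. sample_cost n t (?c j)) (\<lambda>j. j \<in> {..<n}) j"
    by (rule ex_is_arg_min_if_finite)
  then obtain j where j: "j < n" and j_le: "\<And>l. l < n \<Longrightarrow> sample_cost n t (?c j) \<le> sample_cost n t (?c l)"
    unfolding is_arg_min_linorder by blast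
  have min: "sample_cost n t (?c j) \<le> sample_cost n t \<theta>" for \<theta>
  proof -
    obtain l where l: "l < n" "sample_cost n t (?c l) \<le> sample_cost n t \<theta>"
      by (rule critical_angle_le[OF n])
    then show ?thesis using j_le[of l] by linarith
  qed
  obtain l where l: "l < n" "circ (?c l) \<noteq> circ (?c j)" "sample_cost n t (?c l) \<le> sample_cost n t (?c j)"
    using none[of j] j unfolding strict_best_def by (auto simp: not_less)
  have min': "sample_cost n t (?c l) \<le> sample_cost n t \<theta>" for \<theta>
    using l(3) min[of \<theta>] by linarith
  show "\<exists>\<theta> \<theta>'. (\<forall>\<theta>''. sample_cost n t \<theta> \<le> sample_cost n t \<theta>'') \<and>
       (\<forall>\<theta>''. sample_cost n t \<theta>' \<le> sample_cost n t \<theta>'') \<and> circ \<theta> \<noteq> circ \<theta>'"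
    using min min' l(2) by metis
  have "\<not> is_frechet_mean (empirical_measure n x) p" for p
    using min min' l(2) arg_min unfolding is_frechet_mean_def by metis
  then show "frechet_mean (empirical_measure n x) = (THE p. False)"
    by (simp add: frechet_mean_def)
qed

lemma AE_density_arclength_neq:
  assumes f [measurable]: "f \<in> borel_measurable circle_borel"
  shows "AE y in density arclength (\<lambda>y. ennreal (f y)). y \<noteq> circ c"
proof -
  have [measurable]: "circ \<in> borel \<rightarrow>\<^sub>M circle_borel" using circ_measurable[of 0] by simp
  have "countable (range (\<lambda>k :: int. c + 2 * pi * of_int k))" by simp
  moreover have "{t. circ t = circ c} \<subseteq> range (\<lambda>k :: int. c + 2 * pi * of_int k)"
  proof
    fix t assume "t \<in> {t. circ t = circ c}"
    then obtain k where "t = c + 2 * pi * of_int k"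
      using sin_cos_eq_iff[of t c] by (auto simp: circ_def mult_ac)
    then show "t \<in> range (\<lambda>k :: int. c + 2 * pi * of_int k)" by auto
  qed
  ultimately have "countable {t. circ t = circ c}" by (rule countable_subset[rotated])
  then have "{t. circ t = circ c} \<in> null_sets lborel" by (rule countable_imp_null_set_lborel)
  then have "AE t in lborel. circ t \<noteq> circ c" by (rule AE_I') auto
  then have "AE t in density lborel (\<lambda>t. indicator {-pi..<pi} t * ennreal (f (circ t))). circ t \<noteq> circ c"
    by (subst AE_density) auto
  moreover have "{y \<in> space circle_borel. y \<noteq> circ c} \<in> sets circle_borel"
  proof -
    have "space circle_borel - {circ c} \<in> sets circle_borel"
      by (intro sets.Diff sets.top) (auto simp: circle_borel_def sets_restrict_space)
    moreover have "{y \<in> space circle_borel. y \<noteq> circ c} = space circle_borel - {circ c}" by auto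
    ultimately show ?thesis by simp
  qed
  moreover have "density arclength (\<lambda>y. ennreal (f y))
      = distr (density lborel (\<lambda>t. indicator {-pi..<pi} t * ennreal (f (circ t)))) circle_borel circ"
    using density_arclength_unrolled[OF f, of 0] by simp
  ultimately show ?thesis
    by (simp only:) (subst AE_distr_iff; simp)
qed

section \<open>The concentration inequality\<close>

theorem proposition5p2:
  fixes M :: "'a measure" and X :: "nat \<Rightarrow> 'a \<Rightarrow> real \<times> real"
    and f :: "real \<times> real \<Rightarrow> real" and \<mu> :: "(real \<times> real) measure"
    and \<alpha> \<phi> \<delta> x :: real and n :: nat
  assumes delta: "0 < \<delta>" "\<delta> < 1 / 2"
    and f_meas: "f \<in> borel_measurable circle_borel"
    and f_nonneg: "\<And>y. y \<in> S1 \<Longrightarrow> 0 \<le> f y"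
    and mu: "\<mu> = density arclength (\<lambda>y. ennreal (f y))"
    and mu_prob: "prob_space \<mu>"
    and P: "in_class_P f \<alpha> \<phi>"
    and alpha: "alpha_min \<delta> \<le> \<alpha>" "\<alpha> \<le> 1"
    and phi: "\<phi> \<le> \<delta> * phi_max \<alpha>"
    and M: "prob_space M"
    and n: "n \<ge> 1"
    and X_indep: "prob_space.indep_vars M (\<lambda>_. circle_borel) X {1..n}"
    and X_distr: "\<And>i. i \<in> {1..n} \<Longrightarrow> distr M circle_borel (X i) = \<mu>"
    and x: "x > 0"
  shows "let E = {\<omega> \<in> space M.
             circle_dist (frechet_mean (empirical_measure n (\<lambda>i. X i \<omega>))) (frechet_mean \<mu>)
               \<ge> sqrt (B_const \<alpha> \<phi>) * (x / real n) powr (1 / 4)}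
         in E \<in> sets M \<and> measure M E \<le> 2 * exp (- x)"
proof -
  interpret prob_space M by (rule M)
  obtain m where mean: "frechet_mean \<mu> = circ m" and gamma: "0 < gamma_const \<alpha> \<phi>"
    and growth: "\<And>\<theta>. gamma_const \<alpha> \<phi> / (8 * pi\<^sup>2) * (angle_dist (\<theta> - m))\<^sup>2
       \<le> frechet_functional \<mu> (circ \<theta>) - frechet_functional \<mu> (circ m)"
    using frechet_mean_growth[OF delta f_meas f_nonneg mu mu_prob P alpha phi] by blast
  define T where "T = (\<lambda>i \<omega>. angle_of (X i \<omega>))"
  have X_rv [measurable]: "random_variable circle_borel (X i)" if "i \<in> {1..n}" for i
    using X_indep that by (simp add: indep_vars_def)
  have X_S1: "X i \<omega> \<in> S1" if "i \<in> {1..n}" "\<omega> \<in> space M" for i \<omega>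
    using measurable_space[OF X_rv] that by (simp add: space_circle_borel)
  have T_rv [measurable]: "random_variable borel (T i)" if "i \<in> {1..n}" for i
    using that unfolding T_def by measurable
  have T_indep: "indep_vars (\<lambda>_. borel) T {1..n}"
    unfolding T_def by (rule indep_vars_compose2[OF X_indep]) simp
  have T_bound: "\<bar>T i \<omega>\<bar> \<le> pi" if "i \<in> {1..n}" "\<omega> \<in> space M" for i \<omega>
    unfolding T_def by (intro abs_angle_of_le X_S1 that)
  have F_eq: "frechet_functional \<mu> (circ \<theta>) = expectation (\<lambda>\<omega>. 1 / 2 * (angle_dist (T i \<omega> - \<theta>))\<^sup>2)"
    if i: "i \<in> {1..n}" for i \<theta>
  proof -
    have "distr M circle_borel (X i) = distr M circle_borel (\<lambda>\<omega>. circ (T i \<omega>))"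
      using X_S1[OF i] by (intro distr_cong) (auto simp: T_def circ_angle_of)
    then have "\<mu> = distr M circle_borel (\<lambda>\<omega>. circ (T i \<omega>))" using X_distr[OF i] by simp
    then show ?thesis using frechet_functional_circ_distr[OF T_rv[OF i], of \<theta>] by simp
  qed
  have atomless: "AE \<omega> in M. T i \<omega> \<noteq> c" if i: "i \<in> {1..n}" for i c
  proof -
    have "AE y in distr M circle_borel (X i). y \<noteq> circ c"
      unfolding X_distr[OF i] mu by (rule AE_density_arclength_neq[OF f_meas])
    then have "AE \<omega> in M. X i \<omega> \<noteq> circ c" by (rule AE_distrD[OF X_rv[OF i]])
    with AE_space show ?thesis
    proof eventually_elim
      case (elim \<omega>)
      then show ?case using X_S1[OF i] by (auto simp: T_def circ_angle_of)
    qed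
  qed
  define r where "r = sqrt (B_const \<alpha> \<phi>) * (x / real n) powr (1 / 4)"
  define E where "E = {\<omega> \<in> space M. r \<le> circle_dist (frechet_mean (empirical_measure n (\<lambda>i. X i \<omega>))) (frechet_mean \<mu>)}"
  have mean_n: "frechet_mean (empirical_measure n (\<lambda>i. X i \<omega>)) = circ (critical_angle n (\<lambda>i. T i \<omega>) (int j))"
    if "\<omega> \<in> space M" "strict_best n (\<lambda>i. T i \<omega>) j" for \<omega> j
    using that unfolding T_def by (intro frechet_mean_sample(1)[OF n] X_S1)
  have mean_n_undefined: "frechet_mean (empirical_measure n (\<lambda>i. X i \<omega>)) = (THE p. False)"
    if "\<omega> \<in> space M" "\<And>j. \<not> strict_best n (\<lambda>i. T i \<omega>) j" for \<omega>
    using that unfolding T_def by (intro frechet_mean_sample(2)[OF n] X_S1)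
  have E_eq: "E = {\<omega> \<in> space M. (\<exists>j<n. strict_best n (\<lambda>i. T i \<omega>) j \<and> r \<le> angle_dist (critical_angle n (\<lambda>i. T i \<omega>) (int j) - m))
      \<or> ((\<forall>j<n. \<not> strict_best n (\<lambda>i. T i \<omega>) j) \<and> r \<le> circle_dist (THE p. False) (circ m))}"
  proof -
    have "r \<le> circle_dist (frechet_mean (empirical_measure n (\<lambda>i. X i \<omega>))) (circ m) \<longleftrightarrow>
      (\<exists>j<n. strict_best n (\<lambda>i. T i \<omega>) j \<and> r \<le> angle_dist (critical_angle n (\<lambda>i. T i \<omega>) (int j) - m))
      \<or> ((\<forall>j<n. \<not> strict_best n (\<lambda>i. T i \<omega>) j) \<and> r \<le> circle_dist (THE p. False) (circ m))" if \<omega>: "\<omega> \<in> space M" for \<omega>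
    proof (cases "\<exists>j. strict_best n (\<lambda>i. T i \<omega>) j")
      case True
      then obtain j where j: "strict_best n (\<lambda>i. T i \<omega>) j" by auto
      then have "j < n" by (simp add: strict_best_def)
      have *: "angle_dist (critical_angle n (\<lambda>i. T i \<omega>) (int l) - m) = angle_dist (critical_angle n (\<lambda>i. T i \<omega>) (int j) - m)"
        if "strict_best n (\<lambda>i. T i \<omega>) l" for l
        using mean_n[OF \<omega> j] mean_n[OF \<omega> that] by (metis circle_dist_circ)
      have L: "circle_dist (frechet_mean (empirical_measure n (\<lambda>i. X i \<omega>))) (circ m)
          = angle_dist (critical_angle n (\<lambda>i. T i \<omega>) (int j) - m)"
        unfolding mean_n[OF \<omega> j] by (rule circle_dist_circ)
      show ?thesis unfolding L using j \<open>j < n\<close> * by metis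
    next
      case False
      then have "frechet_mean (empirical_measure n (\<lambda>i. X i \<omega>)) = (THE p. False)"
        by (intro mean_n_undefined[OF \<omega>]) simp
      with False show ?thesis by metis
    qed
    then show ?thesis unfolding E_def mean by auto
  qed
  have crit_rv [measurable]: "(\<lambda>\<omega>. critical_angle n (\<lambda>i. T i \<omega>) (int j)) \<in> borel_measurable M" for j
    unfolding critical_angle_def by measurable
  have cost_rv [measurable]: "(\<lambda>\<omega>. sample_cost n (\<lambda>i. T i \<omega>) (critical_angle n (\<lambda>i. T i \<omega>) (int j))) \<in> borel_measurable M" for j
    unfolding sample_cost_def by measurable
  have best_rv [measurable]: "Measurable.pred M (\<lambda>\<omega>. strict_best n (\<lambda>i. T i \<omega>) j)" for j
    unfolding strict_best_def circ_def prod.inject by measurable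
  have E_sets: "E \<in> sets M" unfolding E_eq by measurable

  \<comment> \<open>\<open>\<pi>\<^sup>2 w / 2\<close> is available for the discretisation error \<open>8 \<pi>\<^sup>2 / N\<close>, which dictates \<open>N\<close>.\<close>
  define w where "w = sqrt (x / real n)"
  have w: "w > 0" "w\<^sup>2 = x / n" using x n by (auto simp: w_def)
  define N where "N = nat \<lceil>16 / w\<rceil>"
  have "16 / w > 0" using w by simp
  then have N: "N > 0" "16 / w \<le> N" by (auto simp: N_def)
  define b where "b = (\<lambda>j i \<omega>. if T i \<omega> < grid N (Suc j) then 1 else 0 :: real)"
  define D where "D = (\<lambda>\<omega>. (\<Sum>j<N. \<bar>\<Sum>i=1..n. b j i \<omega> - expectation (b j i)\<bar>) / N)"
  have b_indep: "indep_vars (\<lambda>_. borel) (b j) {1..n}" for j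
    unfolding b_def by (rule indep_vars_compose2[OF T_indep]) measurable
  have tail: "prob {\<omega> \<in> space M. sqrt (n * x / 2) \<le> D \<omega>} \<le> 2 * exp (- x)"
  proof -
    have "prob {\<omega> \<in> space M. sqrt (card {1..n} * x / 2) \<le>
      (\<Sum>j\<in>{..<N}. \<bar>\<Sum>i\<in>{1..n}. b j i \<omega> - expectation (b j i)\<bar>) / card {..<N}} \<le> 2 * exp (- x)"
    proof (rule averaged_deviation_tail[where Y = b and I = "{1..n}" and J = "{..<N}"])
      show "{1..n} \<noteq> {}" "{..<N} \<noteq> {}" using n N by auto
      show "0 \<le> b j i \<omega> \<and> b j i \<omega> \<le> 1" for j i \<omega> by (simp add: b_def)
    qed (use x b_indep in auto)
    then show ?thesis by (simp add: D_def)
  qed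
  have deviation: "\<bar>sample_cost n (\<lambda>i. T i \<omega>) \<theta> - frechet_functional \<mu> (circ \<theta>)\<bar> \<le> 2 * pi\<^sup>2 * (D \<omega> / n) + 4 * pi\<^sup>2 / N"
    if \<omega>: "\<omega> \<in> space M" for \<omega> \<theta>
  proof -
    define \<zeta> where "\<zeta> = (\<lambda>t. 1 / 2 * (angle_dist (t - \<theta>))\<^sup>2)"
    have "\<bar>\<Sum>i=1..n. \<zeta> (T i \<omega>) - expectation (\<lambda>\<omega>. \<zeta> (T i \<omega>))\<bar>
      \<le> pi * (2 * pi / N) * (\<Sum>j<N. \<bar>\<Sum>i=1..n. b j i \<omega> - expectation (b j i)\<bar>)
        + card {1..n} * (2 * (pi * (2 * pi / N)))"
      unfolding b_def
    proof (rule Lipschitz_deviation_le[OF finite_atLeastAtMost T_rv T_bound _ _ N(1) \<omega>])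
      show "\<bar>\<zeta> s - \<zeta> t\<bar> \<le> pi * \<bar>s - t\<bar>" for s t
        unfolding \<zeta>_def by (rule half_sq_angle_dist_Lipschitz)
    qed auto
    also have "\<dots> = n * (2 * pi\<^sup>2 * (D \<omega> / n) + 4 * pi\<^sup>2 / N)"
      using n N by (simp add: D_def power2_eq_square field_simps)
    also have "(\<Sum>i=1..n. \<zeta> (T i \<omega>) - expectation (\<lambda>\<omega>. \<zeta> (T i \<omega>)))
        = n * (sample_cost n (\<lambda>i. T i \<omega>) \<theta> - frechet_functional \<mu> (circ \<theta>))"
    proof -
      have "(\<Sum>i=1..n. expectation (\<lambda>\<omega>. \<zeta> (T i \<omega>))) = (\<Sum>i=1..n. frechet_functional \<mu> (circ \<theta>))"
        using F_eq by (intro sum.cong) (auto simp: \<zeta>_def)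
      moreover have "(\<Sum>i=1..n. \<zeta> (T i \<omega>)) = n * sample_cost n (\<lambda>i. T i \<omega>) \<theta>"
      proof -
        have \<zeta>_alt: "\<zeta> t = 1 / 2 * (angle_dist (\<theta> - t))\<^sup>2" for t
          using angle_dist_uminus[of "t - \<theta>"] by (simp add: \<zeta>_def)
        have "(\<Sum>i=1..n. \<zeta> (T i \<omega>)) = 1 / 2 * (\<Sum>i=1..n. (angle_dist (\<theta> - T i \<omega>))\<^sup>2)"
          unfolding \<zeta>_alt sum_distrib_left ..
        also have "\<dots> = n * sample_cost n (\<lambda>i. T i \<omega>) \<theta>"
          using n by (simp add: sample_cost_def)
        finally show ?thesis .
      qed
      ultimately show ?thesis by (simp add: sum_subtractf right_diff_distrib)
    qed
    finally show ?thesis using n by (simp add: abs_mult)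
  qed
  \<comment> \<open>\<open>C_const / 8\<close> has to cover \<open>3 \<pi>\<^sup>2\<close> from the deviations and \<open>\<pi>\<^sup>2 / 2\<close> from the discretisation.\<close>
  have C: "7 / 2 * pi\<^sup>2 \<le> C_const / 8"
  proof -
    have "3 * pi\<^sup>2 \<le> pi * pi\<^sup>2" using pi_gt3 by (intro mult_right_mono) auto
    moreover have "C_const / 8 = pi * pi\<^sup>2 + 1 / 2 * pi\<^sup>2 + 1 / 2 * pi"
      by (simp add: C_const_def power2_eq_square field_simps)
    ultimately show ?thesis using pi_gt_zero by linarith
  qed
  then have C0: "0 \<le> C_const" using zero_le_power2[of pi] by linarith
  have B: "C_const * pi\<^sup>2 / gamma_const \<alpha> \<phi> \<le> B_const \<alpha> \<phi>"
  proof -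
    have "C_const * (pi\<^sup>2 / gamma_const \<alpha> \<phi>) \<le> B_const \<alpha> \<phi>"
      unfolding B_const_def using C0 by (intro mult_left_mono) auto
    then show ?thesis by simp
  qed
  have r: "0 \<le> r" "r\<^sup>2 = B_const \<alpha> \<phi> * w"
  proof -
    have "0 \<le> C_const * pi\<^sup>2 / gamma_const \<alpha> \<phi>"
      using C0 gamma by (intro divide_nonneg_pos mult_nonneg_nonneg) auto
    then have B0: "0 \<le> B_const \<alpha> \<phi>" using B by linarith
    then show "0 \<le> r" by (simp add: r_def)
    have "((x / real n) powr (1 / 4))\<^sup>2 = (x / real n) powr (1 / 2)"
      by (simp add: power2_eq_square flip: powr_add)
    also have "\<dots> = w" using x n by (simp add: w_def powr_half_sqrt)
    finally show "r\<^sup>2 = B_const \<alpha> \<phi> * w" using B0 by (simp add: r_def power_mult_distrib)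
  qed
  \<comment> \<open>If the empirical mean is far from the true one, the growth of the functional forces a large deviation.\<close>
  have E_imp: "sqrt (n * x / 2) \<le> D \<omega>" if "\<omega> \<in> E" and j: "strict_best n (\<lambda>i. T i \<omega>) j" for \<omega> j
  proof (rule ccontr)
    assume "\<not> ?thesis"
    then have D_less: "D \<omega> < sqrt (n * x / 2)" by simp
    have \<omega>: "\<omega> \<in> space M" using \<open>\<omega> \<in> E\<close> by (simp add: E_def)
    define \<theta> where "\<theta> = critical_angle n (\<lambda>i. T i \<omega>) (int j)"
    have "r \<le> angle_dist (\<theta> - m)"
      using \<open>\<omega> \<in> E\<close> mean_n[OF \<omega> j] by (simp add: E_def mean \<theta>_def circle_dist_circ)
    then have "B_const \<alpha> \<phi> * w \<le> (angle_dist (\<theta> - m))\<^sup>2"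
      using power_mono[OF _ r(1), of "angle_dist (\<theta> - m)" 2] r(2) by simp
    moreover have "C_const * pi\<^sup>2 / gamma_const \<alpha> \<phi> * w \<le> B_const \<alpha> \<phi> * w"
      using B w by (intro mult_right_mono) auto
    ultimately have "C_const * pi\<^sup>2 / gamma_const \<alpha> \<phi> * w \<le> (angle_dist (\<theta> - m))\<^sup>2" by linarith
    then have "gamma_const \<alpha> \<phi> / (8 * pi\<^sup>2) * (C_const * pi\<^sup>2 / gamma_const \<alpha> \<phi> * w)
        \<le> gamma_const \<alpha> \<phi> / (8 * pi\<^sup>2) * (angle_dist (\<theta> - m))\<^sup>2"
      using gamma by (intro mult_left_mono) auto
    also note growth[of \<theta>]
    also have "gamma_const \<alpha> \<phi> / (8 * pi\<^sup>2) * (C_const * pi\<^sup>2 / gamma_const \<alpha> \<phi> * w) = C_const / 8 * w"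
      using gamma by simp
    finally have "C_const / 8 * w \<le> frechet_functional \<mu> (circ \<theta>) - frechet_functional \<mu> (circ m)" .
    moreover have "7 / 2 * pi\<^sup>2 * w \<le> C_const / 8 * w" using C w by (intro mult_right_mono) auto
    ultimately have "7 / 2 * pi\<^sup>2 * w \<le> frechet_functional \<mu> (circ \<theta>) - frechet_functional \<mu> (circ m)"
      by (rule order_trans[rotated])
    also have "\<dots> \<le> 2 * (2 * pi\<^sup>2 * (D \<omega> / n) + 4 * pi\<^sup>2 / N)" (is "_ \<le> 2 * ?e")
    proof -
      have "sample_cost n (\<lambda>i. T i \<omega>) \<theta> \<le> sample_cost n (\<lambda>i. T i \<omega>) m"
        unfolding \<theta>_def by (rule strict_best_minimizes[OF n j])
      moreover have "a - b \<le> 2 * e" if "\<bar>s - a\<bar> \<le> e" "\<bar>s' - b\<bar> \<le> e" "s \<le> s'" for a b s s' e :: real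
        using that by linarith
      ultimately show ?thesis using deviation[OF \<omega>, of \<theta>] deviation[OF \<omega>, of m] by blast
    qed
    also have "\<dots> = pi\<^sup>2 * (4 * (D \<omega> / n) + 8 / N)" by (simp add: algebra_simps)
    also have "7 / 2 * pi\<^sup>2 * w = pi\<^sup>2 * (7 / 2 * w)" by simp
    finally have "pi\<^sup>2 * (7 / 2 * w) \<le> pi\<^sup>2 * (4 * (D \<omega> / n) + 8 / N)" .
    then have "7 / 2 * w \<le> 4 * (D \<omega> / n) + 8 / N"
      by (rule mult_left_le_imp_le) simp
    moreover have "8 / N \<le> w / 2" using N w by (simp add: field_simps)
    moreover have "D \<omega> / n < 3 / 4 * w"
    proof -
      have "sqrt (n * x / 2) \<le> 3 / 4 * w * n"
      proof (rule real_le_lsqrt)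
        have "(3 / 4 * w * n)\<^sup>2 = 9 / 16 * w\<^sup>2 * n\<^sup>2" by (simp add: power2_eq_square)
        also have "\<dots> = 9 / 16 * (x / n) * n\<^sup>2" unfolding w(2) ..
        also have "\<dots> = 9 / 16 * (n * x)" using n by (simp add: power2_eq_square)
        finally have "(3 / 4 * w * n)\<^sup>2 = 9 / 16 * (n * x)" .
        moreover have "0 \<le> real n * x" using x by simp
        ultimately show "n * x / 2 \<le> (3 / 4 * w * n)\<^sup>2" by linarith
      qed (use w in auto)
      then have "D \<omega> < 3 / 4 * w * n" using D_less by linarith
      then show ?thesis using n by (simp add: field_simps)
    qed
    ultimately show False by linarith
  qed
  have no_tie: "AE \<omega> in M. \<forall>\<theta> \<theta>'. (\<forall>\<theta>''. sample_cost n (\<lambda>i. T i \<omega>) \<theta> \<le> sample_cost n (\<lambda>i. T i \<omega>) \<theta>'')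
     \<longrightarrow> (\<forall>\<theta>''. sample_cost n (\<lambda>i. T i \<omega>) \<theta>' \<le> sample_cost n (\<lambda>i. T i \<omega>) \<theta>'') \<longrightarrow> circ \<theta> = circ \<theta>'"
    by (rule AE_no_tie[OF n T_indep]) (rule atomless)
  have "AE \<omega> in M. \<omega> \<in> E \<longrightarrow> \<omega> \<in> {\<omega> \<in> space M. sqrt (n * x / 2) \<le> D \<omega>}"
    using no_tie AE_space
  proof eventually_elim
    case (elim \<omega>)
    then have "\<exists>j. strict_best n (\<lambda>i. T i \<omega>) j"
      using frechet_mean_sample(3)[OF n, of "\<lambda>i. X i \<omega>"] X_S1 unfolding T_def by metis
    then show ?case using E_imp elim by auto
  qed
  moreover have "{\<omega> \<in> space M. sqrt (n * x / 2) \<le> D \<omega>} \<in> sets M"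
  proof -
    have [measurable]: "random_variable borel (b j i)" if "i \<in> {1..n}" for j i
      using that unfolding b_def by measurable
    show ?thesis unfolding D_def by measurable
  qed
  ultimately have "prob E \<le> prob {\<omega> \<in> space M. sqrt (n * x / 2) \<le> D \<omega>}"
    by (rule finite_measure_mono_AE)
  with tail have "prob E \<le> 2 * exp (- x)" by linarith
  with E_sets have "E \<in> sets M \<and> prob E \<le> 2 * exp (- x)" by blast
  then show ?thesis unfolding Let_def E_def r_def .
qed

end
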